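(* Suppose that: (i) $c(x,x')=(x-x')^TA(x)(x-x')$ is lower semicontinuous and there are positive constants $\rho_{\min},\rho_{\max}$ with $\rho_{\min}\le v^TA(x)v\le\rho_{\max}$ for all unit vectors $v$ and $P_0$-almost every $x\in\mathbb{R}^d$; (ii) $\ell:\mathbb{R}\to\mathbb{R}$ is convex, $\inf\{s\ge0:\sup_{u\in\mathbb{R}}(\ell(u)-su^2)<\infty\}$ is finite, and $E_{P_0}\|X\|^4<\infty$; (iii) $\ell$ is twice differentiable with $\ell''(\cdot)\le M$ for a positive constant $M$, and $P_0$ is such that $\ell'(\beta^TX)$ is not identically $0$, for any $\beta\in B$; (iv) $B\subseteq\mathbb{R}^d$ is convex and compact, with $R_\beta:=\sup_{\beta\in B}\|\beta\|<\infty$. For any $\delta\in(0,\delta_1)$ and fixed $\beta\in B\setminus\{\mathbf{0}\}$, there exists a unique worst-case distribution $P_\delta^*$ which attains the supremum in $\sup_{P:D_c(P_0,P)\le\delta}E_P[\ell(\beta^TX)]$. In particular, there exist random variables $\{G_\delta:\delta\in(0,\delta_1)\}$ such that (a) the law of $X_\delta^*:=X+\sqrt\delta\,G_\delta\,A(X)^{-1}\beta$ is $P_\delta^*$; (b) $0<\sqrt\delta\,G_\delta<\sqrt{\delta'}\,G_{\delta'}$ whenever $0<\delta<\delta'<\delta_1$ and $\ell'(\beta^TX)>0$; (c) $\sqrt{\delta'}\,G_{\delta'}<\sqrt\delta\,G_\delta<0$ whenever $0<\delta<\delta'<\delta_1$ and $\ell'(\beta^TX)<0$; and (d) $G_\delta=0$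 whenever $\delta\in(0,\delta_1)$ and $\ell'(\beta^TX)=0$. Therefore, $\|X_\delta^*-X\|\le\|X_{\delta'}^*-X\|$, $P_0$-almost surely, whenever $0<\delta<\delta'<\delta_1$.
   Context: Let $d\ge1$, $B\subseteq\mathbb{R}^d$, $P_0$ a Borel probability measure on $\mathbb{R}^d$, $X\sim P_0$, $\ell:\mathbb{R}\to\mathbb{R}$, and $A:\mathbb{R}^d\to\mathbb{S}_d^{++}$ (real symmetric positive definite $d\times d$ matrices). $E_{P_0}$ denotes expectation with $X\sim P_0$ and $\|\cdot\|$ is the Euclidean norm. The optimal transport cost is $D_c(P_0,P)=\inf_\pi E_\pi[c(X,X')]$, over couplings $\pi$ of $P_0$ and $P$ (Borel probability measures on $\mathbb{R}^d\times\mathbb{R}^d$ with first marginal $P_0$ and second marginal $P$). The random variables $G_\delta$ live on the same probability space as $X$. The constant $\delta_1$ is $$\delta_1=\min\{\delta_0/4,\ c_1^2c_2^2p^2\rho_{\min}^2\rho_{\max}^{-1}\underline L\,\overline L^{-2}/256\},\qquad\delta_0=\rho_{\min}^2\,\underline L\,R_\beta^{-2}M^{-2}\rho_{\max}^{-1},$$ where $\underline L,\overline L>0$ are constants (which exist under the hypotheses) with $\underline L\le E_{P_0}[\ell'(\beta^TX)^2]\le\overline L$ for every $\beta\in B$, and where $c_1,c_2\in(0,\infty)$, $p\in(0,1)$ are the constants of the following non-degeneracy condition: for every $\beta\in B$, $P_0$ is such that there exist $c_1,c_2,p$ satisfying $P_0\big(|\ell'(\beta^TX)|>c_1,\ |\beta^TX|>c_2\|\beta\|\big)\ge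 p$. *)

theory Defs
  imports "HOL-Probability.Probability"
begin

definition sym_pos_def :: "real ^ 'n ^ 'n \<Rightarrow> bool" where
  "sym_pos_def S \<longleftrightarrow> transpose S = S \<and> (\<forall>v. v \<noteq> 0 \<longrightarrow> v \<bullet> (S *v v) > 0)"

definition lower_semicontinuous :: "('a::topological_space \<Rightarrow> real) \<Rightarrow> bool" where
  "lower_semicontinuous f \<longleftrightarrow> (\<forall>z. \<forall>t. t < f z \<longrightarrow> (\<forall>\<^sub>F y in nhds z. t < f y))"

definition mahalanobis_cost ::
    "(real ^ 'n \<Rightarrow> real ^ 'n ^ 'n) \<Rightarrow> real ^ 'n \<Rightarrow> real ^ 'n \<Rightarrow> real" where
  "mahalanobis_cost A x x' = (x - x') \<bullet> (A x *v (x - x'))"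

definition borel_prob :: "'a::topological_space measure \<Rightarrow> bool" where
  "borel_prob P \<longleftrightarrow> prob_space P \<and> sets P = sets borel"

definition couplings ::
    "'a::topological_space measure \<Rightarrow> 'a measure \<Rightarrow> ('a \<times> 'a) measure set" where
  "couplings P Q = {\<pi>. borel_prob \<pi> \<and> distr \<pi> borel fst = P \<and> distr \<pi> borel snd = Q}"

text \<open>Only used for nonnegative costs, as the coercion to \<^typ>\<open>ennreal\<close> truncates
  negative values. The value is infinite if every coupling has infinite cost.\<close>

definition transport_cost ::
    "('a::topological_space \<Rightarrow> 'a \<Rightarrow> real) \<Rightarrow> 'a measure \<Rightarrow> 'a measure \<Rightarrow> ennreal" where
  "transport_cost c P Q = (INF \<pi>\<in>couplings P Q. \<integral>\<^sup>+ z. ennreal (c (fst z) (snd z)) \<partial>\<pi>)"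

definition ambiguity_set ::
    "('a::topological_space \<Rightarrow> 'a \<Rightarrow> real) \<Rightarrow> 'a measure \<Rightarrow> real \<Rightarrow> 'a measure set" where
  "ambiguity_set c P\<^sub>0 \<delta> = {P. borel_prob P \<and> transport_cost c P\<^sub>0 P \<le> ennreal \<delta>}"

text \<open>Expectation with values in the extended reals, so that the supremum below is not affected
  by the Bochner integral being 0 for non-integrable functions. For integrable \<^term>\<open>f\<close> it is
  the Bochner integral; it is infinite if both parts have infinite integral.\<close>

definition ext_expectation :: "'a measure \<Rightarrow> ('a \<Rightarrow> real) \<Rightarrow> ereal" where
  "ext_expectation P f =
     enn2ereal (\<integral>\<^sup>+ x. ennreal (f x) \<partial>P) - enn2ereal (\<integral>\<^sup>+ x. ennreal (- f x) \<partial>P)"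

definition worst_case ::
    "('a::topological_space \<Rightarrow> 'a \<Rightarrow> real) \<Rightarrow> 'a measure \<Rightarrow> real \<Rightarrow> ('a \<Rightarrow> real) \<Rightarrow> 'a measure \<Rightarrow> bool"
  where
  "worst_case c P\<^sub>0 \<delta> f P \<longleftrightarrow>
     P \<in> ambiguity_set c P\<^sub>0 \<delta> \<and>
     ext_expectation P f = (SUP Q\<in>ambiguity_set c P\<^sub>0 \<delta>. ext_expectation Q f)"

definition quadratic_growth_rate :: "(real \<Rightarrow> real) \<Rightarrow> ereal" where
  "quadratic_growth_rate l =
     (INF s\<in>{s::real. 0 \<le> s \<and> (SUP u. ereal (l u - s * u\<^sup>2)) < \<infinity>}. ereal s)"

definition delta0 :: "real \<Rightarrow> real \<Rightarrow> real \<Rightarrow> real \<Rightarrow> real \<Rightarrow> real" where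
  "delta0 \<rho>min \<rho>max L R M = \<rho>min\<^sup>2 * L / (R\<^sup>2 * M\<^sup>2 * \<rho>max)"

definition delta1 ::
    "real \<Rightarrow> real \<Rightarrow> real \<Rightarrow> real \<Rightarrow> real \<Rightarrow> real \<Rightarrow> real \<Rightarrow> real \<Rightarrow> real \<Rightarrow> real" where
  "delta1 \<rho>min \<rho>max Llow Lup R M c\<^sub>1 c\<^sub>2 p =
     min (delta0 \<rho>min \<rho>max Llow R M / 4)
         (c\<^sub>1\<^sup>2 * c\<^sub>2\<^sup>2 * p\<^sup>2 * \<rho>min\<^sup>2 * Llow / (\<rho>max * Lup\<^sup>2) / 256)"

text \<open>The law of \<^term>\<open>transported A \<beta> X g\<close> is the candidate worst-case law when
  \<^term>\<open>g\<close> is the signed displacement, i.e. \<open>sqrt \<delta>\<close> times the random scale.\<close>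

definition transported ::
    "(real ^ 'n \<Rightarrow> real ^ 'n ^ 'n) \<Rightarrow> real ^ 'n \<Rightarrow> ('w \<Rightarrow> real ^ 'n) \<Rightarrow> ('w \<Rightarrow> real) \<Rightarrow> 'w \<Rightarrow> real ^ 'n"
  where
  "transported A \<beta> X g \<omega> = X \<omega> + g \<omega> *\<^sub>R (matrix_inv (A (X \<omega>)) *v \<beta>)"

end

theory Submission
  imports Defs
begin

text \<open>
  Write \<open>u = \<beta> \<bullet> x\<close> and \<open>a = \<beta> \<bullet> A(x)\<^sup>-\<^sup>1 \<beta>\<close>. For a multiplier \<open>\<kappa>\<close> with \<open>M a < 2 \<kappa>\<close>, the function
  \<open>y \<mapsto> \<kappa> c(x, y) - l(\<beta> \<bullet> y)\<close> is strongly convex, and its minimiser is \<open>T x = x + g A(x)\<^sup>-\<^sup>1 \<beta>\<close>, where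
  \<open>g\<close> solves \<open>l'(u + g a) = 2 \<kappa> g\<close>. The cost of the map \<open>T\<close> is \<open>E[g\<^sup>2 a]\<close>; it is continuous and decreasing
  in \<open>\<kappa>\<close>, tends to 0, and is at least \<open>\<delta>\<^sub>0 / 4\<close> at \<open>\<kappa> = M |\<beta>|\<^sup>2 / \<rho>min\<close>, so some larger \<open>\<kappa>\<close> makes it
  equal to \<open>\<delta>\<close>. Weak duality shows that the law of \<open>T X\<close> is then optimal. By strong convexity, a coupling
  of an optimal law with \<open>P\<^sub>0\<close> whose cost exceeds \<open>\<delta>\<close> by \<open>\<epsilon>\<close> has mean squared deviation \<open>O(\<epsilon>)\<close> from
  the graph of \<open>T\<close>, which gives uniqueness. Monotonicity in \<open>\<delta>\<close> holds because \<open>|g|\<close> decreases in \<open>\<kappa>\<close>.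
\<close>

section \<open>Convex functions with bounded second derivative\<close>

locale smooth_convex =
  fixes l :: "real \<Rightarrow> real" and M :: real
  assumes convex: "convex_on UNIV l"
    and differentiable: "\<And>u. l differentiable (at u)" "\<And>u. deriv l differentiable (at u)"
    and M_pos: "0 < M"
    and second_deriv_le: "\<And>u. deriv (deriv l) u \<le> M"
begin

lemma has_deriv: "(l has_real_derivative deriv l u) (at u)"
  and has_second_deriv: "(deriv l has_real_derivative deriv (deriv l) u) (at u)"
  using differentiable by (auto simp: DERIV_deriv_iff_real_differentiable)

lemma continuous_on_deriv: "continuous_on S (deriv l)"
  using DERIV_isCont[OF has_second_deriv] by (simp add: continuous_at_imp_continuous_on)

lemma continuous_on_l: "continuous_on S l"
  using DERIV_isCont[OF has_deriv] by (simp add: continuous_at_imp_continuous_on)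

lemma measurable_l [measurable]: "l \<in> borel_measurable borel"
  and measurable_deriv [measurable]: "deriv l \<in> borel_measurable borel"
  by (intro borel_measurable_continuous_onI continuous_on_l continuous_on_deriv)+

lemma tangent_below: "l u + deriv l u * (v - u) \<le> l v"
  using convex_on_imp_above_tangent[OF convex, of u v "deriv l u"]
    has_field_derivative_at_within[OF has_deriv, of u UNIV] by simp

text \<open>The bound on the second derivative makes \<open>M / 2 * u\<^sup>2 - l u\<close> convex,
  and the tangent inequality for that function rearranges to the claim.\<close>

lemma tangent_above: "l v \<le> l u + deriv l u * (v - u) + M / 2 * (v - u)\<^sup>2"
proof -
  have *: "convex_on UNIV (\<lambda>u. M / 2 * u\<^sup>2 - l u)"
  proof (rule f''_ge0_imp_convex)
    show "((\<lambda>u. M / 2 * u\<^sup>2 - l u) has_real_derivative M * u - deriv l u) (at u)" for u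
      by (auto intro!: derivative_eq_intros has_deriv)
    show "((\<lambda>u. M * u - deriv l u) has_real_derivative M - deriv (deriv l) u) (at u)" for u
      by (auto intro!: derivative_eq_intros has_second_deriv)
  qed (use second_deriv_le in auto)
  have "((\<lambda>u. M / 2 * u\<^sup>2 - l u) has_real_derivative M * u - deriv l u) (at u)"
    by (auto intro!: derivative_eq_intros has_deriv)
  from convex_on_imp_above_tangent[OF *, of u v "M * u - deriv l u"] has_field_derivative_at_within[OF this, of UNIV]
  have "(M * u - deriv l u) * (v - u) \<le> (M / 2 * v\<^sup>2 - l v) - (M / 2 * u\<^sup>2 - l u)"
    by simp
  then show ?thesis
    by (simp add: power2_eq_square field_simps)
qed

lemma deriv_mono: "u \<le> v \<Longrightarrow> deriv l u \<le> deriv l v"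
proof (cases "u = v")
  case False
  assume "u \<le> v"
  then have "0 < v - u" using False by simp
  moreover have "(deriv l v - deriv l u) * (v - u) \<ge> 0"
    using tangent_below[of u v] tangent_below[of v u] by (simp add: algebra_simps)
  ultimately show ?thesis by (simp add: zero_le_mult_iff)
qed simp

text \<open>Adding the quadratic upper bounds based at \<open>u\<close> and at \<open>v\<close>
  cancels the values of \<open>l\<close> and leaves the Lipschitz estimate multiplied by
  \<open>v - u\<close>.\<close>

lemma deriv_diff_le:
  assumes "u \<le> v" shows "deriv l v - deriv l u \<le> M * (v - u)"
proof (cases "u = v")
  case False
  then have "0 < v - u" using assms by simp
  moreover have "(M * (v - u) - (deriv l v - deriv l u)) * (v - u) \<ge> 0"
    using tangent_above[of u v] tangent_above[of v u]
    by (simp add: algebra_simps power2_eq_square)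
  ultimately show ?thesis by (simp add: zero_le_mult_iff)
qed simp

lemma deriv_sq_le: "(deriv l u)\<^sup>2 \<le> 2 * (deriv l 0)\<^sup>2 + 2 * M\<^sup>2 * u\<^sup>2"
proof -
  have "\<bar>deriv l u - deriv l 0\<bar> \<le> M * \<bar>u\<bar>"
  proof (cases "0 \<le> u")
    case True
    then show ?thesis using deriv_mono[of 0 u] deriv_diff_le[of 0 u] by simp
  next
    case False
    then show ?thesis using deriv_mono[of u 0] deriv_diff_le[of u 0] by simp
  qed
  then have "\<bar>deriv l u - deriv l 0\<bar>\<^sup>2 \<le> (M * \<bar>u\<bar>)\<^sup>2" by (intro power_mono) auto
  then have "(deriv l u - deriv l 0)\<^sup>2 \<le> M\<^sup>2 * u\<^sup>2" by (simp add: power_mult_distrib)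
  \<comment> \<open>The difference of the two sides is the square of
    \<open>deriv l u - 2 * deriv l 0\<close>.\<close>
  moreover have "(deriv l u)\<^sup>2 \<le> 2 * (deriv l 0)\<^sup>2 + 2 * (deriv l u - deriv l 0)\<^sup>2"
    using zero_le_power2[of "deriv l u - 2 * deriv l 0"] by (simp add: power2_eq_square algebra_simps)
  ultimately show ?thesis by linarith
qed

lemma abs_l_le: "\<bar>l u\<bar> \<le> \<bar>l 0\<bar> + \<bar>deriv l 0\<bar> * \<bar>u\<bar> + M / 2 * u\<^sup>2"
proof -
  have "\<bar>deriv l 0 * u\<bar> = \<bar>deriv l 0\<bar> * \<bar>u\<bar>" by (simp add: abs_mult)
  moreover have "0 \<le> M / 2 * u\<^sup>2" using M_pos by simp
  ultimately show ?thesis using tangent_below[of 0 u] tangent_above[of u 0] by simp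
qed

section \<open>The scalar first-order condition and its root\<close>

text \<open>For \<open>0 < a\<close> the equation says that \<open>g\<close> is a critical point of
  \<open>l (u + g * a) - \<kappa> * g\<^sup>2 * a\<close>. The description is meaningful when
  \<open>0 \<le> a\<close> and \<open>M * a < 2 * \<kappa>\<close>, where the root exists and is
  unique.\<close>

definition displacement :: "real \<Rightarrow> real \<Rightarrow> real \<Rightarrow> real" where
  "displacement \<kappa> u a = (THE g. deriv l (u + g * a) = 2 * \<kappa> * g)"

text \<open>Since \<open>deriv l\<close> is \<open>M\<close>-Lipschitz, subtracting
  \<open>deriv l (u + g * a)\<close> costs at most \<open>M * a\<close> of the slope
  \<open>2 * \<kappa>\<close>. Uniqueness, existence, comparison and the Lipschitz bound for the
  root all rest on this growth rate.\<close>

lemma displacement_gap: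
  assumes "0 \<le> a" "x \<le> y"
  shows "(2 * \<kappa> - M * a) * (y - x) \<le> (2 * \<kappa> * y - deriv l (u + y * a)) - (2 * \<kappa> * x - deriv l (u + x * a))"
  using deriv_diff_le[of "u + x * a" "u + y * a"] assms mult_right_mono[of x y a]
  by (simp add: algebra_simps)

lemma displacement_unique:
  assumes "0 \<le> a" "M * a < 2 * \<kappa>" "deriv l (u + x * a) = 2 * \<kappa> * x" "deriv l (u + y * a) = 2 * \<kappa> * y"
  shows "x = y"
proof -
  have *: "y \<le> x" if "x \<le> y" "deriv l (u + x * a) = 2 * \<kappa> * x" "deriv l (u + y * a) = 2 * \<kappa> * y" for x y
    using displacement_gap[OF assms(1) that(1), of \<kappa> u] that assms(2) by (simp add: mult_le_0_iff)
  show ?thesis using *[of x y] *[of y x] assms by linarith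
qed

text \<open>The root function equals \<open>- deriv l u\<close> at 0 and grows at rate at least
  \<open>2 * \<kappa> - M * a\<close>. At distance \<open>b\<close> from 0 it has made up for this
  value, so it changes sign on the interval from \<open>-b\<close> to \<open>b\<close>.\<close>

lemma displacement_exists:
  assumes "0 \<le> a" "M * a < 2 * \<kappa>"
  shows "\<exists>g. deriv l (u + g * a) = 2 * \<kappa> * g \<and> \<bar>g\<bar> \<le> \<bar>deriv l u\<bar> / (2 * \<kappa> - M * a)"
proof -
  define b where "b = \<bar>deriv l u\<bar> / (2 * \<kappa> - M * a)"
  let ?F = "\<lambda>g. 2 * \<kappa> * g - deriv l (u + g * a)"
  have b: "0 \<le> b" "(2 * \<kappa> - M * a) * b = \<bar>deriv l u\<bar>" using assms by (auto simp: b_def)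
  have "?F (- b) \<le> 0" using displacement_gap[OF assms(1), of "-b" 0 \<kappa> u] b by (simp add: algebra_simps)
  moreover have "0 \<le> ?F b" using displacement_gap[OF assms(1), of 0 b \<kappa> u] b by (simp add: algebra_simps)
  moreover have "continuous_on {-b..b} ?F"
    by (intro continuous_intros continuous_on_compose2[OF continuous_on_deriv]) auto
  ultimately obtain g where "-b \<le> g" "g \<le> b" "?F g = 0"
    using IVT'[of ?F "-b" 0 b] b by auto
  then show ?thesis unfolding b_def[symmetric] by (intro exI[of _ g]) auto
qed

context
  fixes \<kappa> a :: real
  assumes a: "0 \<le> a" "M * a < 2 * \<kappa>"
begin

lemma
  shows displacement_eq: "deriv l (u + displacement \<kappa> u a * a) = 2 * \<kappa> * displacement \<kappa> u a"
    and abs_displacement_le: "\<bar>displacement \<kappa> u a\<bar> \<le> \<bar>deriv l u\<bar> / (2 * \<kappa> - M * a)"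
proof -
  obtain g where g: "deriv l (u + g * a) = 2 * \<kappa> * g" "\<bar>g\<bar> \<le> \<bar>deriv l u\<bar> / (2 * \<kappa> - M * a)"
    using displacement_exists[OF a] by blast
  then have "displacement \<kappa> u a = g"
    unfolding displacement_def by (intro the_equality displacement_unique[OF a _ g(1)])
  with g show "deriv l (u + displacement \<kappa> u a * a) = 2 * \<kappa> * displacement \<kappa> u a"
    "\<bar>displacement \<kappa> u a\<bar> \<le> \<bar>deriv l u\<bar> / (2 * \<kappa> - M * a)" by auto
qed

text \<open>The root function is strictly increasing, so its sign at \<open>t\<close> tells on which
  side of \<open>t\<close> the root lies. This sign test replaces an explicit formula for the root
  in the measurability and comparison arguments.\<close>

lemma less_displacement_iff: "t < displacement \<kappa> u a \<longleftrightarrow> 2 * \<kappa> * t < deriv l (u + t * a)"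
  and displacement_less_iff: "displacement \<kappa> u a < t \<longleftrightarrow> deriv l (u + t * a) < 2 * \<kappa> * t"
proof -
  let ?F = "\<lambda>g. 2 * \<kappa> * g - deriv l (u + g * a)"
  have *: "?F x < ?F y" if "x < y" for x y
    using displacement_gap[of a x y \<kappa> u] a that mult_pos_pos[of "2 * \<kappa> - M * a" "y - x"] by linarith
  have "?F (displacement \<kappa> u a) = 0" using displacement_eq by simp
  then show "t < displacement \<kappa> u a \<longleftrightarrow> 2 * \<kappa> * t < deriv l (u + t * a)"
    "displacement \<kappa> u a < t \<longleftrightarrow> deriv l (u + t * a) < 2 * \<kappa> * t"
    using *[of t "displacement \<kappa> u a"] *[of "displacement \<kappa> u a" t]
    by (cases t "displacement \<kappa> u a" rule: linorder_cases; auto)+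
qed

lemma displacement_pos_iff: "0 < displacement \<kappa> u a \<longleftrightarrow> 0 < deriv l u"
  and displacement_neg_iff: "displacement \<kappa> u a < 0 \<longleftrightarrow> deriv l u < 0"
  using less_displacement_iff[of 0] displacement_less_iff[of _ 0] by auto

lemma displacement_eq_0_iff: "displacement \<kappa> u a = 0 \<longleftrightarrow> deriv l u = 0"
  using displacement_pos_iff[of u] displacement_neg_iff[of u] by linarith

text \<open>The displacement has the sign of the slope, so moving from \<open>u\<close> along it
  cannot decrease the absolute slope, by monotonicity of \<open>deriv l\<close>. At the end point
  the slope is \<open>2 * \<kappa>\<close> times the displacement.\<close>

lemma abs_deriv_le: "\<bar>deriv l u\<bar> \<le> 2 * \<kappa> * \<bar>displacement \<kappa> u a\<bar>"
proof (cases "0 \<le> displacement \<kappa> u a")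
  case True
  then have "0 \<le> deriv l u" using displacement_neg_iff[of u] by linarith
  then show ?thesis
    using True displacement_eq[of u] deriv_mono[of u "u + displacement \<kappa> u a * a"] a by simp
next
  case False
  then have "deriv l u < 0" using displacement_neg_iff[of u] by linarith
  then show ?thesis
    using False displacement_eq[of u] deriv_mono[of "u + displacement \<kappa> u a * a" u] a
    by (simp add: mult_le_0_iff)
qed

end

text \<open>The root for \<open>\<kappa>'\<close> is positive, so there the slope
  \<open>2 * \<kappa>' * g\<close> exceeds \<open>2 * \<kappa> * g\<close>; the sign test for
  \<open>\<kappa>\<close> then puts it below the root for \<open>\<kappa>\<close>.\<close>

lemma displacement_decreasing:
  assumes "0 \<le> a" "M * a < 2 * \<kappa>" "\<kappa> < \<kappa>'" "0 < deriv l u"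
  shows "displacement \<kappa>' u a < displacement \<kappa> u a"
proof -
  have a: "M * a < 2 * \<kappa>'" using assms by simp
  have "0 < displacement \<kappa>' u a" using displacement_pos_iff[OF assms(1) a] assms by simp
  then show ?thesis
    using less_displacement_iff[OF assms(1,2)] displacement_eq[OF assms(1) a] assms by simp
qed

lemma displacement_increasing:
  assumes "0 \<le> a" "M * a < 2 * \<kappa>" "\<kappa> < \<kappa>'" "deriv l u < 0"
  shows "displacement \<kappa> u a < displacement \<kappa>' u a"
proof -
  have a: "M * a < 2 * \<kappa>'" using assms by simp
  have "displacement \<kappa>' u a < 0" using displacement_neg_iff[OF assms(1) a] assms by simp
  then show ?thesis
    using displacement_less_iff[OF assms(1,2)] displacement_eq[OF assms(1) a] assms
    by simp
qed

lemma abs_displacement_antimono: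
  assumes "0 \<le> a" "M * a < 2 * \<kappa>" "\<kappa> \<le> \<kappa>'"
  shows "\<bar>displacement \<kappa>' u a\<bar> \<le> \<bar>displacement \<kappa> u a\<bar>"
proof (cases "\<kappa> = \<kappa>'")
  case False
  then have less: "\<kappa> < \<kappa>'" and a: "M * a < 2 * \<kappa>'" using assms by auto
  consider "0 < deriv l u" | "deriv l u < 0" | "deriv l u = 0" by linarith
  then show ?thesis
  proof cases
    case 1
    then show ?thesis
      using displacement_decreasing[OF assms(1,2) less] displacement_pos_iff[OF assms(1) a, of u] by fastforce
  next
    case 2
    then show ?thesis
      using displacement_increasing[OF assms(1,2) less] displacement_neg_iff[OF assms(1) a, of u] by fastforce
  next
    case 3
    then show ?thesis using displacement_eq_0_iff[OF assms(1) a, of u] by simp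
  qed
qed simp

text \<open>The root for \<open>\<kappa>'\<close> satisfies the equation for \<open>\<kappa>\<close>
  up to the residual \<open>2 * (\<kappa> - \<kappa>')\<close> times itself, and the growth rate of
  the root function turns this residual into a distance between the roots.\<close>

lemma displacement_lipschitz:
  assumes "0 \<le> a" "M * a < 2 * \<kappa>" "M * a < 2 * \<kappa>'"
  shows "(2 * \<kappa> - M * a) * \<bar>displacement \<kappa> u a - displacement \<kappa>' u a\<bar> \<le> 2 * \<bar>\<kappa> - \<kappa>'\<bar> * \<bar>displacement \<kappa>' u a\<bar>"
proof -
  let ?x = "displacement \<kappa> u a" and ?y = "displacement \<kappa>' u a"
  have "(2 * \<kappa> - M * a) * \<bar>?x - ?y\<bar> \<le> \<bar>2 * (\<kappa> - \<kappa>') * ?y\<bar>"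
    using displacement_gap[OF assms(1), of ?x ?y \<kappa> u] displacement_gap[OF assms(1), of ?y ?x \<kappa> u]
      displacement_eq[OF assms(1,2), of u] displacement_eq[OF assms(1,3), of u]
    by (cases "?x \<le> ?y") (auto simp: algebra_simps)
  then show ?thesis by (simp only: abs_mult abs_numeral)
qed

lemma measurable_displacement:
  assumes [measurable]: "u \<in> borel_measurable N" "a \<in> borel_measurable N"
    and a: "\<And>x. x \<in> space N \<Longrightarrow> 0 \<le> a x \<and> M * a x < 2 * \<kappa>"
  shows "(\<lambda>x. displacement \<kappa> (u x) (a x)) \<in> borel_measurable N"
proof (subst borel_measurable_iff_greater, intro allI)
  fix t
  have "{x \<in> space N. t < displacement \<kappa> (u x) (a x)} = {x \<in> space N. 2 * \<kappa> * t < deriv l (u x + t * a x)}"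
    using a by (auto simp: less_displacement_iff)
  also have "\<dots> \<in> sets N" by measurable
  finally show "{x \<in> space N. t < displacement \<kappa> (u x) (a x)} \<in> sets N" .
qed

end

section \<open>Positive definite matrices\<close>

lemma sym_pos_def_inner_commute:
  assumes "sym_pos_def S" shows "v \<bullet> (S *v w) = w \<bullet> (S *v v)"
  using assms unfolding sym_pos_def_def
  by (metis dot_lmul_matrix inner_commute vector_transpose_matrix)

lemma sym_pos_def_nonneg:
  assumes "sym_pos_def S" shows "0 \<le> v \<bullet> (S *v v)"
  using assms unfolding sym_pos_def_def by (cases "v = 0") (auto simp: less_imp_le)

lemma sym_pos_def_quadratic_add:
  assumes "sym_pos_def S"
  shows "(v + s *\<^sub>R w) \<bullet> (S *v (v + s *\<^sub>R w))
    = v \<bullet> (S *v v) + 2 * s * (v \<bullet> (S *v w)) + s\<^sup>2 * (w \<bullet> (S *v w))"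
  by (simp add: matrix_vector_right_distrib matrix_vector_mult_scaleR inner_add_left inner_add_right
      sym_pos_def_inner_commute[OF assms, of w v] power2_eq_square algebra_simps)

lemma sym_pos_def_invertible:
  assumes "sym_pos_def S" shows "invertible S"
proof -
  have "\<forall>v. S *v v = 0 \<longrightarrow> v = 0"
    using assms unfolding sym_pos_def_def by (metis inner_zero_right less_irrefl)
  then show ?thesis
    using matrix_left_invertible_ker[of S] invertible_left_inverse by blast
qed

lemma sym_pos_def_mult_inv:
  assumes "sym_pos_def S" shows "S *v (matrix_inv S *v b) = b"
proof -
  have "S ** matrix_inv S = mat 1 \<and> matrix_inv S ** S = mat 1"
    using sym_pos_def_invertible[OF assms] unfolding invertible_def matrix_inv_def by (rule someI_ex)
  then show ?thesis by (simp add: matrix_vector_mul_assoc)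
qed

lemma sym_pos_def_inv_pos:
  assumes "sym_pos_def S" "b \<noteq> 0" shows "0 < b \<bullet> (matrix_inv S *v b)"
proof -
  have "matrix_inv S *v b \<noteq> 0" using sym_pos_def_mult_inv[OF assms(1), of b] assms(2) by auto
  then have "0 < (matrix_inv S *v b) \<bullet> (S *v (matrix_inv S *v b))"
    using assms(1) unfolding sym_pos_def_def by blast
  then show ?thesis by (simp add: sym_pos_def_mult_inv[OF assms(1)] inner_commute)
qed

text \<open>Cauchy-Schwarz for the inner product of \<open>S\<close>, applied to \<open>v\<close>
  and \<open>matrix_inv S *v b\<close>. The coefficient in the proof removes from \<open>v\<close>
  its \<open>S\<close>-orthogonal projection onto that vector.\<close>

lemma sym_pos_def_Cauchy_Schwarz:
  assumes "sym_pos_def S" "b \<noteq> 0"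
  shows "(b \<bullet> v)\<^sup>2 \<le> (b \<bullet> (matrix_inv S *v b)) * (v \<bullet> (S *v v))"
proof -
  let ?z = "matrix_inv S *v b" and ?a = "b \<bullet> (matrix_inv S *v b)"
  have a: "0 < ?a" by (rule sym_pos_def_inv_pos[OF assms])
  have "0 \<le> (v + (- (b \<bullet> v) / ?a) *\<^sub>R ?z) \<bullet> (S *v (v + (- (b \<bullet> v) / ?a) *\<^sub>R ?z))"
    by (rule sym_pos_def_nonneg[OF assms(1)])
  also have "\<dots> = v \<bullet> (S *v v) - (b \<bullet> v)\<^sup>2 / ?a"
    using a unfolding sym_pos_def_quadratic_add[OF assms(1)]
    by (simp add: sym_pos_def_mult_inv[OF assms(1)] inner_commute[of _ b] power2_eq_square field_simps)
  finally show ?thesis using a by (simp add: field_simps)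
qed

lemma
  fixes S :: "real ^ 'n ^ 'n"
  assumes "\<forall>v. norm v = 1 \<longrightarrow> r \<le> v \<bullet> (S *v v) \<and> v \<bullet> (S *v v) \<le> R"
  shows quadratic_form_ge: "r * (norm v)\<^sup>2 \<le> v \<bullet> (S *v v)"
    and quadratic_form_le: "v \<bullet> (S *v v) \<le> R * (norm v)\<^sup>2"
proof -
  have "r * (norm v)\<^sup>2 \<le> v \<bullet> (S *v v) \<and> v \<bullet> (S *v v) \<le> R * (norm v)\<^sup>2"
  proof (cases "v = 0")
    case False
    let ?w = "v /\<^sub>R norm v"
    have eq: "v \<bullet> (S *v v) = (?w \<bullet> (S *v ?w)) * (norm v)\<^sup>2"
      using False by (simp add: matrix_vector_mult_scaleR power2_eq_square field_simps)
    have "norm ?w = 1" using False by simp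
    then show ?thesis
      unfolding eq using assms by (intro conjI mult_right_mono) (auto simp del: inner_scaleR_left)
  qed simp
  then show "r * (norm v)\<^sup>2 \<le> v \<bullet> (S *v v)" "v \<bullet> (S *v v) \<le> R * (norm v)\<^sup>2" by auto
qed

text \<open>The upper bound comes from coercivity of \<open>S\<close> at
  \<open>matrix_inv S *v b\<close> together with the Euclidean Cauchy-Schwarz inequality; the lower
  bound from the weighted Cauchy-Schwarz inequality with \<open>v = b\<close>.\<close>

lemma
  assumes S: "sym_pos_def S" and r: "0 < r"
    and bounds: "\<forall>v. norm v = 1 \<longrightarrow> r \<le> v \<bullet> (S *v v) \<and> v \<bullet> (S *v v) \<le> R"
  shows inv_form_le: "b \<bullet> (matrix_inv S *v b) \<le> (norm b)\<^sup>2 / r"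
    and inv_form_ge: "(norm b)\<^sup>2 / R \<le> b \<bullet> (matrix_inv S *v b)"
proof -
  let ?z = "matrix_inv S *v b"
  have "r * (norm ?z)\<^sup>2 \<le> ?z \<bullet> (S *v ?z)" by (rule quadratic_form_ge[OF bounds])
  also have "\<dots> = b \<bullet> ?z" by (simp add: sym_pos_def_mult_inv[OF S] inner_commute)
  also have "\<dots> \<le> norm b * norm ?z" by (rule norm_cauchy_schwarz)
  finally have "(r * norm ?z) * norm ?z \<le> norm b * norm ?z" by (simp add: power2_eq_square mult.assoc)
  then have le: "r * norm ?z \<le> norm b"
    by (cases "?z = 0") (auto simp: mult_le_cancel_right)
  then have norm: "norm ?z \<le> norm b / r" using r by (simp add: field_simps)
  have "b \<bullet> ?z \<le> norm b * norm ?z" by (rule norm_cauchy_schwarz)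
  also have "\<dots> \<le> norm b * (norm b / r)" by (intro mult_left_mono norm) auto
  finally show "b \<bullet> ?z \<le> (norm b)\<^sup>2 / r" by (simp add: power2_eq_square)
  show "(norm b)\<^sup>2 / R \<le> b \<bullet> ?z"
  proof (cases "b = 0")
    case False
    then have a: "0 < b \<bullet> ?z" by (rule sym_pos_def_inv_pos[OF S])
    have pos: "0 < (norm b)\<^sup>2" using False by simp
    then have "0 < R * (norm b)\<^sup>2" using quadratic_form_ge[OF bounds, of b] quadratic_form_le[OF bounds, of b] r
      by (smt (verit) mult_pos_pos)
    then have R: "0 < R" using pos by (simp add: zero_less_mult_iff)
    have "(norm b)\<^sup>2 * (norm b)\<^sup>2 = (b \<bullet> b)\<^sup>2" by (simp add: dot_square_norm power2_eq_square)
    also have "\<dots> \<le> (b \<bullet> ?z) * (b \<bullet> (S *v b))" by (rule sym_pos_def_Cauchy_Schwarz[OF S False])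
    also have "\<dots> \<le> (b \<bullet> ?z) * (R * (norm b)\<^sup>2)"
      using a by (intro mult_left_mono quadratic_form_le[OF bounds]) auto
    finally have "(norm b)\<^sup>2 * (norm b)\<^sup>2 \<le> ((b \<bullet> ?z) * R) * (norm b)\<^sup>2" by (simp only: mult.assoc)
    then have "(norm b)\<^sup>2 \<le> (b \<bullet> ?z) * R" using pos by (rule mult_right_le_imp_le)
    then show ?thesis using R by (simp add: field_simps)
  qed simp
qed

section \<open>Measurability of the matrix field and of its inverse\<close>

lemma lower_semicontinuous_measurable:
  assumes "lower_semicontinuous f" shows "f \<in> borel_measurable borel"
proof (subst borel_measurable_iff_greater, intro allI)
  fix t
  have "open {z. t < f z}"
  proof (subst open_subopen, intro ballI)
    fix z assume "z \<in> {z. t < f z}"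
    then have "\<forall>\<^sub>F y in nhds z. t < f y"
      using assms unfolding lower_semicontinuous_def by blast
    then obtain T where "open T" "z \<in> T" "\<forall>y\<in>T. t < f y"
      unfolding eventually_nhds by blast
    then show "\<exists>T. open T \<and> z \<in> T \<and> T \<subseteq> {z. t < f z}" by blast
  qed
  then show "{z \<in> space borel. t < f z} \<in> sets borel" by simp
qed

lemma measurable_det:
  fixes A :: "'a \<Rightarrow> real ^ 'n ^ 'n"
  assumes "\<And>i j. (\<lambda>x. A x $ i $ j) \<in> borel_measurable N"
  shows "(\<lambda>x. det (A x)) \<in> borel_measurable N"
  unfolding det_def by (intro borel_measurable_sum borel_measurable_times borel_measurable_const borel_measurable_prod assms)

lemma measurable_vec_lambda:
  fixes f :: "'a \<Rightarrow> real ^ 'n"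
  assumes "\<And>i. (\<lambda>x. f x $ i) \<in> borel_measurable N"
  shows "f \<in> borel_measurable N"
  using assms by (subst borel_measurable_euclidean_space) (auto simp: Basis_vec_def inner_axis)

text \<open>By Cramer's rule each component is a quotient of two determinants, which are polynomials
  in measurable entries.\<close>

lemma measurable_matrix_inv_mult:
  fixes A :: "'a \<Rightarrow> real ^ 'n ^ 'n"
  assumes A: "\<And>i j. (\<lambda>x. A x $ i $ j) \<in> borel_measurable N"
    and spd: "\<And>x. sym_pos_def (A x)"
  shows "(\<lambda>x. matrix_inv (A x) *v b) \<in> borel_measurable N"
proof (rule measurable_vec_lambda)
  fix k
  have eq: "(matrix_inv (A x) *v b) $ k = det (\<chi> i j. if j = k then b $ i else A x $ i $ j) / det (A x)" for x
  proof -
    have "det (A x) \<noteq> 0" using sym_pos_def_invertible[OF spd] invertible_det_nz by blast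
    from cramer[OF this, of "matrix_inv (A x) *v b" b] sym_pos_def_mult_inv[OF spd]
    show ?thesis by simp
  qed
  have "(\<lambda>x. det (A x)) \<in> borel_measurable N" by (rule measurable_det[OF A])
  moreover have "(\<lambda>x. det (\<chi> i j. if j = k then b $ i else A x $ i $ j)) \<in> borel_measurable N"
  proof (rule measurable_det)
    show "(\<lambda>x. (\<chi> i j. if j = k then b $ i else A x $ i $ j) $ i $ j) \<in> borel_measurable N" for i j
      using A[of i j] by (cases "j = k") auto
  qed
  ultimately
  show "(\<lambda>x. (matrix_inv (A x) *v b) $ k) \<in> borel_measurable N"
    unfolding eq by (intro borel_measurable_divide)
qed

text \<open>Measurability of \<open>A\<close> is recovered from that of the cost by polarisation: a
  second difference in the second argument removes the constant and linear terms and leaves twice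
  the bilinear form, evaluated here at two axis vectors.\<close>

lemma measurable_mahalanobis_entry:
  fixes A :: "real ^ 'n \<Rightarrow> real ^ 'n ^ 'n"
  assumes spd: "\<And>x. sym_pos_def (A x)"
    and cost: "(\<lambda>z. mahalanobis_cost A (fst z) (snd z)) \<in> borel_measurable borel"
  shows "(\<lambda>x. A x $ i $ j) \<in> borel_measurable borel"
proof -
  have cost': "(\<lambda>x. mahalanobis_cost A x y) \<in> borel_measurable borel" for y
  proof -
    have "(\<lambda>x. (x, y)) \<in> borel_measurable borel"
      by (intro borel_measurable_continuous_onI continuous_intros)
    from measurable_compose[OF this cost] show ?thesis by simp
  qed
  have "A x $ i $ j = axis i 1 \<bullet> (A x *v axis j 1)" for x
    by (simp add: inner_axis' matrix_vector_mul_component inner_axis)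
  moreover have "2 * (u \<bullet> (A x *v v)) = mahalanobis_cost A x (u + v) - mahalanobis_cost A x u
      - mahalanobis_cost A x v + mahalanobis_cost A x 0" for x u v
    by (simp add: mahalanobis_cost_def matrix_vector_right_distrib matrix_vector_mult_diff_distrib
        inner_add_left inner_diff_left inner_add_right inner_diff_right
        sym_pos_def_inner_commute[OF spd, of v x u] sym_pos_def_inner_commute[OF spd, of x x u]
        sym_pos_def_inner_commute[OF spd, of x x v])
  ultimately have eq: "A x $ i $ j = (mahalanobis_cost A x (axis i 1 + axis j 1) - mahalanobis_cost A x (axis i 1)
      - mahalanobis_cost A x (axis j 1) + mahalanobis_cost A x 0) / 2" for x
    by (metis nonzero_mult_div_cancel_left zero_neq_numeral)
  show ?thesis unfolding eq by (intro borel_measurable_divide borel_measurable_add borel_measurable_diff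
      borel_measurable_const cost')
qed

section \<open>Couplings\<close>

lemma ext_expectation_eq_integral:
  assumes "integrable P f" shows "ext_expectation P f = ereal (integral\<^sup>L P f)"
proof -
  have *: "(\<integral>\<^sup>+ x. ennreal (f x) \<partial>P) < \<top>" "(\<integral>\<^sup>+ x. ennreal (- f x) \<partial>P) < \<top>"
    using assms unfolding real_integrable_def by (auto simp: less_top)
  have "enn2ereal t = ereal (enn2real t)" if "t < \<top>" for t
    using that by (cases t) auto
  then show ?thesis
    unfolding ext_expectation_def real_lebesgue_integral_def[OF assms] using * by simp
qed

section \<open>Lipschitz test functions determine finite Borel measures\<close>

lemma max_infdist_tendsto_indicator:
  fixes C :: "'a::metric_space set"
  assumes "closed C" "C \<noteq> {}"
  shows "(\<lambda>n. max 0 (1 - real n * infdist y C)) \<longlonglongrightarrow> indicator C y"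
proof (cases "y \<in> C")
  case True
  then show ?thesis by simp
next
  case False
  then have pos: "0 < infdist y C"
    using assms in_closed_iff_infdist_zero[of C y] infdist_nonneg[of y C] by linarith
  have "\<forall>\<^sub>F n in sequentially. 1 / infdist y C \<le> real n"
    using filterlim_real_sequentially unfolding filterlim_at_top by blast
  then have "\<forall>\<^sub>F n in sequentially. max 0 (1 - real n * infdist y C) = indicator C y"
    by eventually_elim (use pos False in \<open>simp add: field_simps\<close>)
  then show ?thesis by (rule tendsto_eventually)
qed

lemma lipschitz_on_max_infdist:
  fixes C :: "'a::metric_space set"
  shows "(real n)-lipschitz_on UNIV (\<lambda>y. max 0 (1 - real n * infdist y C))"
proof (rule lipschitz_onI)
  fix x y :: 'a
  have "dist (max 0 (1 - real n * infdist x C)) (max 0 (1 - real n * infdist y C))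
      \<le> \<bar>real n * (infdist x C - infdist y C)\<bar>"
    by (simp add: dist_real_def algebra_simps abs_if max_def)
  also have "\<dots> \<le> real n * dist x y"
    unfolding abs_mult by (simp add: mult_left_mono infdist_triangle_abs)
  finally show "dist (max 0 (1 - real n * infdist x C)) (max 0 (1 - real n * infdist y C)) \<le> real n * dist x y" .
qed simp

text \<open>Dominated convergence along the Lipschitz approximations of an indicator gives equality
  on closed sets, which form an intersection-stable generator of the Borel sets.\<close>

lemma borel_measure_eqI_lipschitz:
  fixes P Q :: "'a::metric_space measure"
  assumes P: "finite_measure P" "sets P = sets borel" and Q: "finite_measure Q" "sets Q = sets borel"
    and eq: "\<And>f :: 'a \<Rightarrow> real. \<And>K. K-lipschitz_on UNIV f \<Longrightarrow> (\<And>x. 0 \<le> f x \<and> f x \<le> 1) \<Longrightarrow>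
      integral\<^sup>L P f = integral\<^sup>L Q f"
  shows "P = Q"
proof -
  interpret P: finite_measure P by fact
  interpret Q: finite_measure Q by fact
  have closed_eq: "emeasure P C = emeasure Q C" if "closed C" for C
  proof (cases "C = {}")
    case False
    define f where "f n y = max 0 (1 - real n * infdist y C)" for n :: nat and y
    have f_bounds: "0 \<le> f n y \<and> f n y \<le> 1" for n y
      by (simp add: f_def infdist_nonneg)
    have [measurable]: "f n \<in> borel_measurable borel" for n
      unfolding f_def by (intro borel_measurable_continuous_onI continuous_intros)
    have [measurable]: "f n \<in> borel_measurable P" "f n \<in> borel_measurable Q" for n
      by (simp_all add: measurable_cong_sets[OF P(2) refl] measurable_cong_sets[OF Q(2) refl])
    have C: "C \<in> sets P" "C \<in> sets Q" using that P Q by auto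
    have lim: "(\<lambda>n. f n y) \<longlonglongrightarrow> indicator C y" for y
      unfolding f_def by (rule max_infdist_tendsto_indicator[OF that False])
    have "(\<lambda>n. integral\<^sup>L P (f n)) \<longlonglongrightarrow> integral\<^sup>L P (indicator C)"
      by (rule integral_dominated_convergence[where w="\<lambda>_. 1"])
        (use C lim f_bounds in \<open>auto intro: borel_measurable_indicator\<close>)
    moreover have "(\<lambda>n. integral\<^sup>L Q (f n)) \<longlonglongrightarrow> integral\<^sup>L Q (indicator C)"
      by (rule integral_dominated_convergence[where w="\<lambda>_. 1"])
        (use C lim f_bounds in \<open>auto intro: borel_measurable_indicator\<close>)
    moreover have "integral\<^sup>L P (f n) = integral\<^sup>L Q (f n)" for n
      by (rule eq[OF lipschitz_on_max_infdist[of n C, folded f_def]]) (rule f_bounds)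
    ultimately have "integral\<^sup>L P (indicator C) = (integral\<^sup>L Q (indicator C) :: real)"
      using LIMSEQ_unique by simp
    then have "measure P C = measure Q C" using C by simp
    then show ?thesis by (simp add: P.emeasure_eq_measure Q.emeasure_eq_measure)
  qed simp
  have sigma: "sets borel = sigma_sets UNIV (Collect closed :: 'a set set)"
    by (simp add: borel_eq_closed)
  show ?thesis
  proof (rule measure_eqI_generator_eq[of "Collect closed" UNIV P Q "\<lambda>_. UNIV"])
    show "Int_stable (Collect closed :: 'a set set)" by (auto simp: Int_stable_def)
  qed (use closed_eq P Q sigma in \<open>auto simp: P.emeasure_eq_measure\<close>)
qed

section \<open>Marginals, graph couplings and near-optimal couplings\<close>

lemma measurable_fst_borel [simp]: "fst \<in> borel_measurable borel"
  and measurable_snd_borel [simp]: "snd \<in> borel_measurable borel"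
  by (intro borel_measurable_continuous_onI continuous_intros)+

lemma couplingsD:
  assumes "\<pi> \<in> couplings P Q"
  shows "prob_space \<pi>" "sets \<pi> = sets borel"
    and "distr \<pi> borel fst = P" "distr \<pi> borel snd = Q"
    and "fst \<in> measurable \<pi> borel" "snd \<in> measurable \<pi> borel"
  using assms by (auto simp: couplings_def borel_prob_def measurable_cong_sets[of \<pi> borel])

lemma
  fixes f :: "'a::topological_space \<Rightarrow> real"
  assumes "\<pi> \<in> couplings P Q" "f \<in> borel_measurable borel"
  shows integrable_coupling_fst: "integrable \<pi> (\<lambda>z. f (fst z)) \<longleftrightarrow> integrable P f"
    and integral_coupling_fst: "(\<integral>z. f (fst z) \<partial>\<pi>) = integral\<^sup>L P f"
    and integrable_coupling_snd: "integrable \<pi> (\<lambda>z. f (snd z)) \<longleftrightarrow> integrable Q f"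
    and integral_coupling_snd: "(\<integral>z. f (snd z) \<partial>\<pi>) = integral\<^sup>L Q f"
  using integrable_distr_eq[of fst \<pi> borel f] integral_distr[of fst \<pi> borel f]
    integrable_distr_eq[of snd \<pi> borel f] integral_distr[of snd \<pi> borel f]
    assms couplingsD[OF assms(1)] by auto

lemma AE_coupling_fst:
  assumes "\<pi> \<in> couplings P Q" "AE x in P. R x"
  shows "AE z in \<pi>. R (fst z)"
  using AE_distrD[OF couplingsD(5)[OF assms(1)], of R] assms(2)
  unfolding couplingsD(3)[OF assms(1)] by simp

lemma graph_coupling:
  fixes P :: "'a::{second_countable_topology, t2_space} measure"
  assumes P: "borel_prob P" and T [measurable]: "T \<in> borel_measurable borel"
  shows "distr P borel (\<lambda>x. (x, T x)) \<in> couplings P (distr P borel T)"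
proof -
  have sets: "sets P = sets borel" using P by (simp add: borel_prob_def)
  have [measurable]: "T \<in> measurable P borel" "(\<lambda>x. x) \<in> measurable P borel"
    "(\<lambda>x. (x, T x)) \<in> measurable P borel"
    by (simp_all add: measurable_cong_sets[OF sets refl])
  have "distr (distr P borel (\<lambda>x. (x, T x))) borel fst = P"
    by (subst distr_distr) (auto simp: comp_def sets intro!: distr_id2)
  moreover have "distr (distr P borel (\<lambda>x. (x, T x))) borel snd = distr P borel T"
    by (subst distr_distr) (auto simp: comp_def)
  ultimately show ?thesis
    using P by (auto simp: couplings_def borel_prob_def intro!: prob_space.prob_space_distr)
qed

text \<open>Near-optimal couplings suffice here, so no optimal coupling has to exist.\<close>

lemma eq_distr_if_couplings_concentrate:
  fixes P Q :: "'a::{second_countable_topology, metric_space} measure"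
  assumes P: "borel_prob P" and Q: "borel_prob Q" and T [measurable]: "T \<in> borel_measurable borel"
    and close: "\<And>\<eta>::real. 0 < \<eta> \<Longrightarrow> \<exists>\<pi>\<in>couplings P Q. \<exists>d. integrable \<pi> d \<and>
      (AE z in \<pi>. (dist (snd z) (T (fst z)))\<^sup>2 \<le> d z) \<and> integral\<^sup>L \<pi> d \<le> \<eta>"
  shows "Q = distr P borel T"
proof -
  have TP: "T \<in> measurable P borel"
    using P by (simp add: borel_prob_def measurable_cong_sets[of P borel])
  have PT: "prob_space (distr P borel T)"
    using P TP by (auto simp: borel_prob_def intro!: prob_space.prob_space_distr)
  show ?thesis
  proof (rule borel_measure_eqI_lipschitz)
    fix f :: "'a \<Rightarrow> real" and K
    assume lip: "K-lipschitz_on UNIV f" and f01: "\<And>x. 0 \<le> f x \<and> f x \<le> 1"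
    have K: "0 \<le> K" using lip by (rule lipschitz_on_nonneg)
    have f [measurable]: "f \<in> borel_measurable borel"
      by (intro borel_measurable_continuous_onI lipschitz_on_continuous_on[OF lip])
    have fT: "(\<lambda>x. f (T x)) \<in> borel_measurable borel" by measurable
    have "\<bar>integral\<^sup>L Q f - integral\<^sup>L (distr P borel T) f\<bar> \<le> 2 * K * s" if s: "0 < s" for s
    proof -
      obtain \<pi> d where \<pi>: "\<pi> \<in> couplings P Q" and d: "integrable \<pi> d"
          "AE z in \<pi>. (dist (snd z) (T (fst z)))\<^sup>2 \<le> d z" "integral\<^sup>L \<pi> d \<le> s\<^sup>2"
        using close[of "s\<^sup>2"] s by auto
      interpret \<pi>: prob_space \<pi> by (rule couplingsD(1)[OF \<pi>])
      note [measurable] = couplingsD(5,6)[OF \<pi>]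
      have fT': "integral\<^sup>L (distr P borel T) f = (\<integral>x. f (T x) \<partial>P)"
        by (rule integral_distr[OF TP f])
      have int: "integrable \<pi> (\<lambda>z. f (snd z))" "integrable \<pi> (\<lambda>z. f (T (fst z)))"
        by (rule \<pi>.integrable_const_bound[where B=1]; use f01 in auto)+
      have "\<bar>integral\<^sup>L Q f - integral\<^sup>L (distr P borel T) f\<bar> = \<bar>\<integral>z. f (snd z) - f (T (fst z)) \<partial>\<pi>\<bar>"
        using int by (simp add: fT' integral_coupling_snd[OF \<pi> f] integral_coupling_fst[OF \<pi> fT])
      also have "\<dots> \<le> (\<integral>z. \<bar>f (snd z) - f (T (fst z))\<bar> \<partial>\<pi>)"
        by (rule integral_abs_bound)
      \<comment> \<open>Only the squared deviation \<open>r\<^sup>2\<close> is controlled in mean,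
        so \<open>r\<close> is replaced by \<open>s + r\<^sup>2 / s\<close>. With a mean of at most
        \<open>s\<^sup>2\<close> this integrates to at most \<open>2 * s\<close>.\<close>
      also have "\<dots> \<le> (\<integral>z. K * (s + d z / s) \<partial>\<pi>)"
      proof (rule integral_mono_AE)
        show "AE z in \<pi>. \<bar>f (snd z) - f (T (fst z))\<bar> \<le> K * (s + d z / s)"
          using d(2)
        proof eventually_elim
          case (elim z)
          let ?r = "dist (snd z) (T (fst z))"
          have "2 * (?r * s) \<le> s * s + ?r\<^sup>2"
            using zero_le_power2[of "?r - s"] by (simp add: power2_eq_square algebra_simps)
          moreover have "0 \<le> ?r * s" using s by simp
          ultimately have "?r * s \<le> s * s + ?r\<^sup>2" by linarith
          then have "?r \<le> s + ?r\<^sup>2 / s" using s by (simp add: field_simps)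
          also have "\<dots> \<le> s + d z / s" using elim s by (simp add: divide_right_mono)
          finally have "K * ?r \<le> K * (s + d z / s)" using K by (rule mult_left_mono)
          then show ?case
            using lipschitz_onD[OF lip, of "snd z" "T (fst z)"] by (simp add: dist_real_def)
        qed
      qed (use int d in auto)
      also have "\<dots> = K * (s + integral\<^sup>L \<pi> d / s)" using d(1) \<pi>.prob_space by simp
      also have "\<dots> \<le> K * (s + s\<^sup>2 / s)"
        using d(3) s K by (intro mult_left_mono add_left_mono divide_right_mono) auto
      finally show ?thesis using s by (simp add: power2_eq_square)
    qed
    note bound = this
    have "\<bar>integral\<^sup>L Q f - integral\<^sup>L (distr P borel T) f\<bar> \<le> 0 + e" if "0 < e" for e
    proof (cases "K = 0")
      case True
      then show ?thesis using bound[of 1] that by simp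
    next
      case False
      then show ?thesis using bound[of "e / (2 * K)"] that K by simp
    qed
    then have "\<bar>integral\<^sup>L Q f - integral\<^sup>L (distr P borel T) f\<bar> \<le> 0"
      by (rule field_le_epsilon)
    then show "integral\<^sup>L Q f = integral\<^sup>L (distr P borel T) f" by simp
  qed (use Q PT in \<open>auto simp: borel_prob_def prob_space_def\<close>)
qed

text \<open>The slack makes the inequality strict, so some coupling lies below the bound without
  attainment of the infimum. Finiteness of its cost also gives integrability.\<close>

lemma ambiguity_set_coupling:
  assumes Q: "Q \<in> ambiguity_set c P \<delta>" and "0 \<le> \<delta>" "0 < \<epsilon>"
    and c: "(\<lambda>z. c (fst z) (snd z)) \<in> borel_measurable borel" "\<And>x y. 0 \<le> c x y"
  obtains \<pi> where "\<pi> \<in> couplings P Q" "integrable \<pi> (\<lambda>z. c (fst z) (snd z))"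
    "(\<integral>z. c (fst z) (snd z) \<partial>\<pi>) \<le> \<delta> + \<epsilon>"
proof -
  have "transport_cost c P Q \<le> ennreal \<delta>" using Q by (simp add: ambiguity_set_def)
  also have "\<dots> < ennreal (\<delta> + \<epsilon>)" using assms by (simp add: ennreal_lessI)
  finally obtain \<pi> where \<pi>: "\<pi> \<in> couplings P Q"
    and less: "(\<integral>\<^sup>+ z. ennreal (c (fst z) (snd z)) \<partial>\<pi>) < ennreal (\<delta> + \<epsilon>)"
    unfolding transport_cost_def INF_less_iff by blast
  have c': "(\<lambda>z. c (fst z) (snd z)) \<in> borel_measurable \<pi>"
    using c(1) by (simp add: measurable_cong_sets[OF couplingsD(2)[OF \<pi>] refl])
  have int: "integrable \<pi> (\<lambda>z. c (fst z) (snd z))"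
    using less c' c(2) by (intro integrableI_nonneg) (auto intro: less_trans)
  moreover have "(\<integral>z. c (fst z) (snd z) \<partial>\<pi>) \<le> \<delta> + \<epsilon>"
    using less c(2) unfolding nn_integral_eq_integral[OF int AE_I2[OF c(2)]]
    by (subst (asm) ennreal_less_iff) (auto intro: integral_nonneg)
  ultimately show thesis using that \<pi> by blast
qed

lemma transport_cost_leI:
  assumes "\<pi> \<in> couplings P Q" "(\<integral>\<^sup>+ z. ennreal (c (fst z) (snd z)) \<partial>\<pi>) \<le> b"
  shows "transport_cost c P Q \<le> b"
  unfolding transport_cost_def using assms by (intro INF_lower2)

section \<open>The dual multiplier and the transport map\<close>

locale quadratic_transport = smooth_convex l M for l M +
  fixes P :: "(real ^ 'n) measure" and A :: "real ^ 'n \<Rightarrow> real ^ 'n ^ 'n"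
    and \<beta> :: "real ^ 'n" and rmin rmax :: real
  assumes P: "borel_prob P"
    and spd: "\<And>x. sym_pos_def (A x)"
    and cost_measurable: "(\<lambda>z. mahalanobis_cost A (fst z) (snd z)) \<in> borel_measurable borel"
    and rmin_pos: "0 < rmin" and rmax_pos: "0 < rmax"
    and ellipticity: "AE x in P. \<forall>v. norm v = 1 \<longrightarrow> rmin \<le> v \<bullet> (A x *v v) \<and> v \<bullet> (A x *v v) \<le> rmax"
    and second_moment: "integrable P (\<lambda>x. (norm x)\<^sup>2)"
    and beta_nonzero: "\<beta> \<noteq> 0"
begin

sublocale P: prob_space P
  using P by (simp add: borel_prob_def)

lemma sets_P [measurable_cong]: "sets P = sets borel"
  using P by (simp add: borel_prob_def)

text \<open>Ellipticity bounds \<open>\<beta> \<bullet> (matrix_inv (A x) *v \<beta>)\<close> by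
  this constant. Multipliers are kept at or above \<open>M * K\<close>, twice the value at which
  \<open>2 * \<kappa> - M * K\<close> vanishes, so that this gap is at least
  \<open>M * K\<close>.\<close>

definition K :: real where "K = (norm \<beta>)\<^sup>2 / rmin"

lemma K_pos: "0 < K"
  using beta_nonzero rmin_pos by (simp add: K_def)

lemma MK_pos: "0 < M * K"
  using M_pos K_pos by simp

text \<open>The cap at \<open>K\<close> changes \<open>weight\<close> only on a null set, and makes the displacement below
  well defined at every point.\<close>

definition weight :: "real ^ 'n \<Rightarrow> real" where
  "weight x = min (\<beta> \<bullet> (matrix_inv (A x) *v \<beta>)) K"

lemma weight_pos: "0 < weight x" and weight_le: "weight x \<le> K"
  using sym_pos_def_inv_pos[OF spd beta_nonzero] K_pos by (auto simp: weight_def)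

lemma AE_weight: "AE x in P. weight x = \<beta> \<bullet> (matrix_inv (A x) *v \<beta>) \<and> (norm \<beta>)\<^sup>2 / rmax \<le> weight x"
  using ellipticity
proof eventually_elim
  case (elim x)
  show ?case
    using inv_form_le[OF spd rmin_pos elim, of \<beta>] inv_form_ge[OF spd rmin_pos elim, of \<beta>]
    by (simp add: weight_def K_def)
qed

lemma measurable_direction [measurable]: "(\<lambda>x. matrix_inv (A x) *v \<beta>) \<in> borel_measurable borel"
  by (intro measurable_matrix_inv_mult measurable_mahalanobis_entry spd cost_measurable)

lemma measurable_weight [measurable]: "weight \<in> borel_measurable borel"
  unfolding weight_def by measurable

definition shift :: "real \<Rightarrow> real ^ 'n \<Rightarrow> real" where
  "shift \<kappa> x = displacement \<kappa> (\<beta> \<bullet> x) (weight x)"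

definition transport_map :: "real \<Rightarrow> real ^ 'n \<Rightarrow> real ^ 'n" where
  "transport_map \<kappa> x = x + shift \<kappa> x *\<^sub>R (matrix_inv (A x) *v \<beta>)"

definition slope_energy :: real where
  "slope_energy = (\<integral>x. (deriv l (\<beta> \<bullet> x))\<^sup>2 \<partial>P)"

text \<open>The mean cost of moving \<open>P\<close> by \<open>transport_map \<kappa>\<close>, in
  scalar form; the integrand is identified with the cost almost everywhere in
  \<open>AE_cost_transport_map\<close>.\<close>

definition budget :: "real \<Rightarrow> real" where
  "budget \<kappa> = (\<integral>x. (shift \<kappa> x)\<^sup>2 * weight x \<partial>P)"

lemma integrable_slope: "integrable P (\<lambda>x. (deriv l (\<beta> \<bullet> x))\<^sup>2)"
proof (rule Bochner_Integration.integrable_bound)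
  show "integrable P (\<lambda>x. 2 * (deriv l 0)\<^sup>2 + 2 * M\<^sup>2 * ((norm \<beta>)\<^sup>2 * (norm x)\<^sup>2))"
    using second_moment by simp
  have "(deriv l (\<beta> \<bullet> x))\<^sup>2 \<le> 2 * (deriv l 0)\<^sup>2 + 2 * M\<^sup>2 * ((norm \<beta>)\<^sup>2 * (norm x)\<^sup>2)" for x
  proof -
    have "(\<beta> \<bullet> x)\<^sup>2 \<le> (norm \<beta>)\<^sup>2 * (norm x)\<^sup>2"
      using Cauchy_Schwarz_ineq[of \<beta> x] by (simp add: dot_square_norm)
    then have "2 * M\<^sup>2 * (\<beta> \<bullet> x)\<^sup>2 \<le> 2 * M\<^sup>2 * ((norm \<beta>)\<^sup>2 * (norm x)\<^sup>2)"
      by (intro mult_left_mono) auto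
    then show ?thesis using deriv_sq_le[of "\<beta> \<bullet> x"] by linarith
  qed
  from order_trans[OF this abs_ge_self]
  show "AE x in P. norm ((deriv l (\<beta> \<bullet> x))\<^sup>2) \<le> norm (2 * (deriv l 0)\<^sup>2 + 2 * M\<^sup>2 * ((norm \<beta>)\<^sup>2 * (norm x)\<^sup>2))"
    by (intro AE_I2) simp
qed measurable

context
  fixes \<kappa> :: real
  assumes \<kappa>: "M * K \<le> \<kappa>"
begin

lemma M_weight_less: "M * weight x < 2 * \<kappa>"
  and gap_pos: "0 < 2 * \<kappa> - M * K"
  and gap_le: "2 * \<kappa> - M * K \<le> 2 * \<kappa> - M * weight x"
proof -
  have "M * weight x \<le> M * K" using M_pos weight_le by (intro mult_left_mono) auto
  then show "M * weight x < 2 * \<kappa>" "0 < 2 * \<kappa> - M * K" "2 * \<kappa> - M * K \<le> 2 * \<kappa> - M * weight x"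
    using \<kappa> MK_pos by linarith+
qed

lemmas weight_gap = less_imp_le[OF weight_pos] M_weight_less

lemma measurable_shift [measurable]: "shift \<kappa> \<in> borel_measurable borel"
  unfolding shift_def using weight_gap by (intro measurable_displacement) auto

lemma measurable_transport_map [measurable]: "transport_map \<kappa> \<in> borel_measurable borel"
  unfolding transport_map_def by measurable

lemma abs_shift_le: "\<bar>shift \<kappa> x\<bar> \<le> \<bar>deriv l (\<beta> \<bullet> x)\<bar> / (2 * \<kappa> - M * K)"
proof -
  have "\<bar>shift \<kappa> x\<bar> \<le> \<bar>deriv l (\<beta> \<bullet> x)\<bar> / (2 * \<kappa> - M * weight x)"
    unfolding shift_def by (rule abs_displacement_le[OF weight_gap])
  also have "\<dots> \<le> \<bar>deriv l (\<beta> \<bullet> x)\<bar> / (2 * \<kappa> - M * K)"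
    using gap_pos gap_le[of x] M_weight_less[of x] by (intro divide_left_mono mult_pos_pos) auto
  finally show ?thesis .
qed

lemma shift_sq_weight_le: "(shift \<kappa> x)\<^sup>2 * weight x \<le> K / (2 * \<kappa> - M * K)\<^sup>2 * (deriv l (\<beta> \<bullet> x))\<^sup>2"
proof -
  have "\<bar>shift \<kappa> x\<bar>\<^sup>2 \<le> (\<bar>deriv l (\<beta> \<bullet> x)\<bar> / (2 * \<kappa> - M * K))\<^sup>2"
    by (intro power_mono abs_shift_le) auto
  then have "(shift \<kappa> x)\<^sup>2 * weight x \<le> (\<bar>deriv l (\<beta> \<bullet> x)\<bar> / (2 * \<kappa> - M * K))\<^sup>2 * K"
    using weight_le weight_pos[of x] by (intro mult_mono) auto
  then show ?thesis by (simp add: power_divide mult.commute)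
qed

lemma integrable_shift_sq_weight: "integrable P (\<lambda>x. (shift \<kappa> x)\<^sup>2 * weight x)"
proof (rule Bochner_Integration.integrable_bound)
  show "integrable P (\<lambda>x. K / (2 * \<kappa> - M * K)\<^sup>2 * (deriv l (\<beta> \<bullet> x))\<^sup>2)"
    using integrable_slope by simp
  show "AE x in P. norm ((shift \<kappa> x)\<^sup>2 * weight x) \<le> norm (K / (2 * \<kappa> - M * K)\<^sup>2 * (deriv l (\<beta> \<bullet> x))\<^sup>2)"
    using shift_sq_weight_le less_imp_le[OF weight_pos] K_pos by (intro AE_I2) (simp add: abs_mult)
qed measurable

text \<open>The bound tends to 0 as the multiplier grows, so arbitrarily small positive radii can be
  reached.\<close>

lemma budget_le: "budget \<kappa> \<le> K / (2 * \<kappa> - M * K)\<^sup>2 * slope_energy"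
proof -
  have "budget \<kappa> \<le> (\<integral>x. K / (2 * \<kappa> - M * K)\<^sup>2 * (deriv l (\<beta> \<bullet> x))\<^sup>2 \<partial>P)"
    unfolding budget_def using integrable_slope
    by (intro integral_mono integrable_shift_sq_weight shift_sq_weight_le) simp
  then show ?thesis by (simp add: slope_energy_def)
qed

text \<open>Combines the lower bound of the displacement by the slope with the lower bound of
  \<open>weight\<close> by ellipticity. At \<open>\<kappa> = M * K\<close> it yields the range of
  radii covered by the theorem.\<close>

lemma budget_ge: "(norm \<beta>)\<^sup>2 / (4 * \<kappa>\<^sup>2 * rmax) * slope_energy \<le> budget \<kappa>"
proof -
  have "(\<integral>x. (norm \<beta>)\<^sup>2 / (4 * \<kappa>\<^sup>2 * rmax) * (deriv l (\<beta> \<bullet> x))\<^sup>2 \<partial>P) \<le> budget \<kappa>"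
    unfolding budget_def
  proof (rule integral_mono_AE)
    show "AE x in P. (norm \<beta>)\<^sup>2 / (4 * \<kappa>\<^sup>2 * rmax) * (deriv l (\<beta> \<bullet> x))\<^sup>2 \<le> (shift \<kappa> x)\<^sup>2 * weight x"
      using AE_weight
    proof eventually_elim
      case (elim x)
      have pos: "0 < \<kappa>" using \<kappa> MK_pos by simp
      have "\<bar>deriv l (\<beta> \<bullet> x)\<bar>\<^sup>2 \<le> (2 * \<kappa> * \<bar>shift \<kappa> x\<bar>)\<^sup>2"
        unfolding shift_def by (intro power_mono abs_deriv_le[OF weight_gap]) auto
      then have "(deriv l (\<beta> \<bullet> x))\<^sup>2 / (4 * \<kappa>\<^sup>2) \<le> (shift \<kappa> x)\<^sup>2"
        using pos by (simp add: power_mult_distrib field_simps)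
      then have "(deriv l (\<beta> \<bullet> x))\<^sup>2 / (4 * \<kappa>\<^sup>2) * ((norm \<beta>)\<^sup>2 / rmax) \<le> (shift \<kappa> x)\<^sup>2 * weight x"
        using elim rmax_pos by (intro mult_mono) auto
      then show ?case by (simp add: field_simps)
    qed
  qed (use integrable_slope integrable_shift_sq_weight in auto)
  then show ?thesis by (simp add: slope_energy_def)
qed

text \<open>The first-order condition for \<^const>\<open>displacement\<close> cancels the terms linear in
  \<open>y - transport_map \<kappa> x\<close>; what remains is the strong convexity of
  \<open>y \<mapsto> \<kappa> c(x, y) - l(\<beta> \<bullet> y)\<close>.\<close>

lemma quadratic_deficiency:
  "AE x in P. \<forall>y. M * K / 2 * rmin * (norm (y - transport_map \<kappa> x))\<^sup>2 \<le>
     l (\<beta> \<bullet> transport_map \<kappa> x) - \<kappa> * ((shift \<kappa> x)\<^sup>2 * weight x)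
       + \<kappa> * mahalanobis_cost A x y - l (\<beta> \<bullet> y)"
  using ellipticity AE_weight
proof eventually_elim
  case (elim x)
  define z where "z = matrix_inv (A x) *v \<beta>"
  define g where "g = shift \<kappa> x"
  have a: "weight x = \<beta> \<bullet> z" using elim(2) by (simp add: z_def)
  have Az: "A x *v z = \<beta>" by (simp add: z_def sym_pos_def_mult_inv[OF spd])
  have T: "transport_map \<kappa> x = x + g *\<^sub>R z" by (simp add: transport_map_def g_def z_def)
  have foc: "deriv l (\<beta> \<bullet> transport_map \<kappa> x) = 2 * \<kappa> * g"
    using displacement_eq[OF weight_gap, of "\<beta> \<bullet> x" x]
    by (simp add: T g_def shift_def a inner_add_right)
  show ?case
  proof
    fix y
    define v where "v = y - transport_map \<kappa> x"
    let ?q = "v \<bullet> (A x *v v)"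
    define w where "w = v + g *\<^sub>R z"
    have "x - y = - w" by (simp add: v_def w_def T)
    then have "mahalanobis_cost A x y = w \<bullet> (A x *v w)"
      by (simp add: mahalanobis_cost_def linear_neg[OF matrix_vector_mul_linear])
    then have cost: "mahalanobis_cost A x y = ?q + 2 * g * (v \<bullet> \<beta>) + g\<^sup>2 * weight x"
      unfolding w_def sym_pos_def_quadratic_add[OF spd] by (simp add: Az a inner_commute)
    have "\<beta> \<bullet> y - \<beta> \<bullet> transport_map \<kappa> x = v \<bullet> \<beta>"
      by (simp add: v_def inner_diff_right inner_commute[of _ \<beta>])
    then have loss: "l (\<beta> \<bullet> y) \<le> l (\<beta> \<bullet> transport_map \<kappa> x) + 2 * \<kappa> * g * (v \<bullet> \<beta>) + M / 2 * (v \<bullet> \<beta>)\<^sup>2"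
      using tangent_above[of "\<beta> \<bullet> y" "\<beta> \<bullet> transport_map \<kappa> x"] by (simp add: foc)
    have q: "rmin * (norm v)\<^sup>2 \<le> ?q" by (rule quadratic_form_ge[OF elim(1)])
    have q0: "0 \<le> ?q" by (rule sym_pos_def_nonneg[OF spd])
    \<comment> \<open>Half of \<open>M * K * ?q\<close> pays for the curvature of \<open>l\<close>;
      the other half is the modulus of strong convexity in the claim.\<close>
    have "(v \<bullet> \<beta>)\<^sup>2 \<le> weight x * ?q"
      using sym_pos_def_Cauchy_Schwarz[OF spd beta_nonzero, of v x] by (simp add: a z_def inner_commute)
    also have "\<dots> \<le> K * ?q" using weight_le q0 by (rule mult_right_mono)
    finally have "M / 2 * (v \<bullet> \<beta>)\<^sup>2 \<le> M / 2 * (K * ?q)" using M_pos by (intro mult_left_mono) auto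
    moreover have "M * K / 2 * (rmin * (norm v)\<^sup>2) \<le> M * K / 2 * ?q"
      using q MK_pos by (intro mult_left_mono) auto
    moreover have "M * K * ?q \<le> \<kappa> * ?q" using \<kappa> q0 by (rule mult_right_mono)
    ultimately show "M * K / 2 * rmin * (norm (y - transport_map \<kappa> x))\<^sup>2 \<le>
      l (\<beta> \<bullet> transport_map \<kappa> x) - \<kappa> * ((shift \<kappa> x)\<^sup>2 * weight x) + \<kappa> * mahalanobis_cost A x y - l (\<beta> \<bullet> y)"
      using loss unfolding cost v_def[symmetric] g_def[symmetric] by (simp add: algebra_simps)
  qed
qed

lemma AE_cost_transport_map:
  "AE x in P. mahalanobis_cost A x (transport_map \<kappa> x) = (shift \<kappa> x)\<^sup>2 * weight x"
  using AE_weight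
proof eventually_elim
  case (elim x)
  show ?case
    by (simp add: elim mahalanobis_cost_def transport_map_def linear_neg[OF matrix_vector_mul_linear]
        matrix_vector_mult_scaleR sym_pos_def_mult_inv[OF spd] inner_commute power2_eq_square)
qed

end

section \<open>Dependence of the budget on the multiplier\<close>

lemma budget_antimono:
  assumes "M * K \<le> \<kappa>" "\<kappa> \<le> \<kappa>'" shows "budget \<kappa>' \<le> budget \<kappa>"
  unfolding budget_def
proof (rule integral_mono)
  show "integrable P (\<lambda>x. (shift \<kappa>' x)\<^sup>2 * weight x)" "integrable P (\<lambda>x. (shift \<kappa> x)\<^sup>2 * weight x)"
    using assms by (auto intro!: integrable_shift_sq_weight)
  show "(shift \<kappa>' x)\<^sup>2 * weight x \<le> (shift \<kappa> x)\<^sup>2 * weight x" for x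
    using abs_displacement_antimono[OF less_imp_le[OF weight_pos] M_weight_less[OF assms(1)] assms(2), of "\<beta> \<bullet> x" x]
      less_imp_le[OF weight_pos[of x]]
    by (auto simp: shift_def abs_le_square_iff intro!: mult_right_mono)
qed

text \<open>Supplies the continuity for the intermediate value theorem. With \<open>d\<close> the
  absolute slope, the difference of the two shifts is at most
  \<open>2 * \<bar>\<kappa> - \<kappa>'\<bar> * d / (M * K)\<^sup>2\<close>, their sum at most
  \<open>2 * d / (M * K)\<close>, and the weight at most \<open>K\<close>; the product gives the
  constant.\<close>

lemma budget_lipschitz: "(4 * K / (M * K) ^ 3 * slope_energy)-lipschitz_on {M * K..} budget"
proof (rule lipschitz_onI)
  have "0 \<le> slope_energy" by (simp add: slope_energy_def)
  then show "0 \<le> 4 * K / (M * K) ^ 3 * slope_energy" using K_pos MK_pos by simp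
  fix \<kappa> \<kappa>' assume "\<kappa> \<in> {M * K..}" "\<kappa>' \<in> {M * K..}"
  then have k: "M * K \<le> \<kappa>" "M * K \<le> \<kappa>'" by auto
  let ?C = "4 * K / (M * K) ^ 3"
  have pointwise: "\<bar>(shift \<kappa> x)\<^sup>2 * weight x - (shift \<kappa>' x)\<^sup>2 * weight x\<bar>
      \<le> ?C * \<bar>\<kappa> - \<kappa>'\<bar> * (deriv l (\<beta> \<bullet> x))\<^sup>2" for x
  proof -
    let ?s = "shift \<kappa> x" and ?t = "shift \<kappa>' x" and ?d = "\<bar>deriv l (\<beta> \<bullet> x)\<bar>"
    have bound: "\<bar>shift j x\<bar> \<le> ?d / (M * K)" if "M * K \<le> j" for j
    proof -
      have "\<bar>shift j x\<bar> \<le> ?d / (2 * j - M * K)" by (rule abs_shift_le[OF that])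
      also have "\<dots> \<le> ?d / (M * K)" using that gap_pos[OF that] M_pos K_pos by (intro divide_left_mono mult_pos_pos) auto
      finally show ?thesis .
    qed
    have "M * K * \<bar>?s - ?t\<bar> \<le> (2 * \<kappa> - M * weight x) * \<bar>?s - ?t\<bar>"
      using gap_le[OF k(1), of x] k(1) by (intro mult_right_mono) auto
    also have "\<dots> \<le> 2 * \<bar>\<kappa> - \<kappa>'\<bar> * \<bar>?t\<bar>"
      unfolding shift_def using less_imp_le[OF weight_pos] M_weight_less k by (intro displacement_lipschitz) auto
    also have "\<dots> \<le> 2 * \<bar>\<kappa> - \<kappa>'\<bar> * (?d / (M * K))" by (intro mult_left_mono bound k) auto
    finally have diff: "\<bar>?s - ?t\<bar> \<le> 2 * \<bar>\<kappa> - \<kappa>'\<bar> * (?d / (M * K)) / (M * K)"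
      using MK_pos by (simp add: pos_le_divide_eq mult.commute)
    have sum: "\<bar>?s + ?t\<bar> \<le> 2 * (?d / (M * K))" using bound[OF k(1)] bound[OF k(2)] by linarith
    have "\<bar>?s\<^sup>2 * weight x - ?t\<^sup>2 * weight x\<bar> = \<bar>?s - ?t\<bar> * \<bar>?s + ?t\<bar> * weight x"
      using weight_pos[of x] unfolding left_diff_distrib[symmetric]
      by (simp add: abs_mult power2_eq_square square_diff_square_factored)
    also have "\<dots> \<le> (2 * \<bar>\<kappa> - \<kappa>'\<bar> * (?d / (M * K)) / (M * K)) * (2 * (?d / (M * K))) * K"
      using diff sum weight_le[of x] weight_pos[of x] MK_pos by (intro mult_mono mult_nonneg_nonneg) auto
    also have "\<dots> = ?C * \<bar>\<kappa> - \<kappa>'\<bar> * ?d\<^sup>2"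
      by (simp add: power2_eq_square power3_eq_cube)
    finally show ?thesis by simp
  qed
  have "dist (budget \<kappa>) (budget \<kappa>') = \<bar>\<integral>x. (shift \<kappa> x)\<^sup>2 * weight x - (shift \<kappa>' x)\<^sup>2 * weight x \<partial>P\<bar>"
    unfolding dist_real_def budget_def using integrable_shift_sq_weight k by simp
  also have "\<dots> \<le> (\<integral>x. \<bar>(shift \<kappa> x)\<^sup>2 * weight x - (shift \<kappa>' x)\<^sup>2 * weight x\<bar> \<partial>P)"
    by (rule integral_abs_bound)
  also have "\<dots> \<le> (\<integral>x. ?C * \<bar>\<kappa> - \<kappa>'\<bar> * (deriv l (\<beta> \<bullet> x))\<^sup>2 \<partial>P)"
    using integrable_slope integrable_shift_sq_weight k pointwise by (intro integral_mono) auto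
  also have "\<dots> = ?C * slope_energy * dist \<kappa> \<kappa>'" by (simp add: slope_energy_def dist_real_def)
  finally show "dist (budget \<kappa>) (budget \<kappa>') \<le> ?C * slope_energy * dist \<kappa> \<kappa>'" .
qed

lemma multiplier_exists:
  assumes "0 < \<delta>" "\<delta> \<le> budget (M * K)"
  shows "\<exists>\<kappa>\<ge>M * K. budget \<kappa> = \<delta>"
proof -
  \<comment> \<open>The point \<open>j\<close> is chosen so that the gap
    \<open>2 * j - M * K\<close> is \<open>q\<close>. As \<open>q\<close> is at least 1 and at least
    \<open>K * slope_energy / \<delta>\<close>, so is \<open>q\<^sup>2\<close>, and
    \<open>budget_le\<close> pushes the budget at \<open>j\<close> down to
    \<open>\<delta>\<close>.\<close>
  define q where "q = M * K + K * slope_energy / \<delta> + 1"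
  define j where "j = (q + M * K) / 2"
  have E: "0 \<le> slope_energy" by (simp add: slope_energy_def)
  have frac: "0 \<le> K * slope_energy / \<delta>" using E assms K_pos by simp
  then have q: "1 \<le> q" "K * slope_energy / \<delta> \<le> q" "M * K \<le> q" using MK_pos by (auto simp: q_def)
  have "2 * j = q + M * K" by (simp add: j_def)
  then have j: "M * K \<le> j" "2 * j - M * K = q" using q by linarith+
  have "q * 1 \<le> q * q" using q(1) by (intro mult_left_mono) auto
  then have "K * slope_energy / \<delta> \<le> q * q" using q(2) by linarith
  then have "K / q\<^sup>2 * slope_energy \<le> \<delta>" using assms q by (simp add: field_simps power2_eq_square)
  then have "budget j \<le> \<delta>" using budget_le[OF j(1)] unfolding j(2) by linarith
  moreover have "continuous_on {M * K..j} budget"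
    by (rule continuous_on_subset[OF lipschitz_on_continuous_on[OF budget_lipschitz]]) auto
  ultimately show ?thesis using IVT2'[of budget j \<delta> "M * K"] assms j by auto
qed

end

section \<open>Optimality and uniqueness\<close>

context quadratic_transport
begin

abbreviation "cost \<equiv> mahalanobis_cost A"

lemma cost_nonneg: "0 \<le> cost x y"
  unfolding mahalanobis_cost_def by (rule sym_pos_def_nonneg[OF spd])

lemma measurable_loss: "(\<lambda>y. l (\<beta> \<bullet> y)) \<in> borel_measurable borel"
  by measurable

lemma AE_norm_sq_le_cost: "AE x in P. \<forall>y. (norm (x - y))\<^sup>2 \<le> cost x y / rmin"
  using ellipticity
proof eventually_elim
  case (elim x)
  show ?case
    using quadratic_form_ge[OF elim] rmin_pos by (auto simp: mahalanobis_cost_def field_simps)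
qed

lemma abs_loss_le: "\<bar>l (\<beta> \<bullet> y)\<bar> \<le> (\<bar>l 0\<bar> + \<bar>deriv l 0\<bar>) + (\<bar>deriv l 0\<bar> + M / 2) * (norm \<beta>)\<^sup>2 * (norm y)\<^sup>2"
proof -
  let ?u = "\<beta> \<bullet> y"
  have "\<bar>?u\<bar> \<le> 1 + ?u\<^sup>2"
    using zero_le_power2[of "\<bar>?u\<bar> - 1"] by (simp add: power2_eq_square algebra_simps abs_if split: if_splits)
  then have "\<bar>deriv l 0\<bar> * \<bar>?u\<bar> \<le> \<bar>deriv l 0\<bar> * (1 + ?u\<^sup>2)" by (rule mult_left_mono) simp
  then have "\<bar>l ?u\<bar> \<le> (\<bar>l 0\<bar> + \<bar>deriv l 0\<bar>) + (\<bar>deriv l 0\<bar> + M / 2) * ?u\<^sup>2"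
    using abs_l_le[of ?u] by (simp add: algebra_simps)
  also have "\<dots> \<le> (\<bar>l 0\<bar> + \<bar>deriv l 0\<bar>) + (\<bar>deriv l 0\<bar> + M / 2) * ((norm \<beta>)\<^sup>2 * (norm y)\<^sup>2)"
    using Cauchy_Schwarz_ineq[of \<beta> y] M_pos
    by (intro add_left_mono mult_left_mono) (auto simp: dot_square_norm)
  finally show ?thesis by (simp add: mult.assoc)
qed

text \<open>By ellipticity a coupling of finite cost carries the second moment of \<open>P\<close>
  over to \<open>Q\<close>, and the loss grows at most quadratically. Hence extended expectations
  over the ambiguity set are ordinary integrals.\<close>

lemma integrable_loss:
  assumes \<pi>: "\<pi> \<in> couplings P Q" and int: "integrable \<pi> (\<lambda>z. cost (fst z) (snd z))"
  shows "integrable Q (\<lambda>y. l (\<beta> \<bullet> y))"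
proof -
  interpret \<pi>: prob_space \<pi> by (rule couplingsD(1)[OF \<pi>])
  note [measurable] = couplingsD(5,6)[OF \<pi>]
  define C where "C = (\<bar>deriv l 0\<bar> + M / 2) * (norm \<beta>)\<^sup>2"
  have C: "0 \<le> C" using M_pos by (simp add: C_def)
  define g where "g z = (\<bar>l 0\<bar> + \<bar>deriv l 0\<bar>) + C * (2 * (norm (fst z))\<^sup>2 + 2 * (cost (fst z) (snd z) / rmin))" for z
  have "integrable \<pi> (\<lambda>z. (norm (fst z))\<^sup>2)"
    using integrable_coupling_fst[OF \<pi>, of "\<lambda>x. (norm x)\<^sup>2"] second_moment by simp
  then have "integrable \<pi> g"
    unfolding g_def using int by simp
  moreover have "(\<lambda>z. l (\<beta> \<bullet> snd z)) \<in> borel_measurable \<pi>" by measurable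
  moreover have "AE z in \<pi>. norm (l (\<beta> \<bullet> snd z)) \<le> norm (g z)"
    using AE_coupling_fst[OF \<pi> AE_norm_sq_le_cost]
  proof eventually_elim
    case (elim z)
    have "norm (snd z) \<le> norm (fst z) + norm (fst z - snd z)"
      using norm_triangle_ineq4[of "fst z" "fst z - snd z"] by simp
    then have "(norm (snd z))\<^sup>2 \<le> (norm (fst z) + norm (fst z - snd z))\<^sup>2" by (rule power_mono) simp
    also have "\<dots> \<le> 2 * (norm (fst z))\<^sup>2 + 2 * (norm (fst z - snd z))\<^sup>2"
      using zero_le_power2[of "norm (fst z) - norm (fst z - snd z)"] by (simp add: power2_eq_square algebra_simps)
    also have "\<dots> \<le> 2 * (norm (fst z))\<^sup>2 + 2 * (cost (fst z) (snd z) / rmin)"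
      by (intro add_left_mono mult_left_mono) (use elim in auto)
    finally have "C * (norm (snd z))\<^sup>2 \<le> C * (2 * (norm (fst z))\<^sup>2 + 2 * (cost (fst z) (snd z) / rmin))"
      using C by (rule mult_left_mono)
    then show ?case using abs_loss_le[of "snd z"] by (simp add: g_def C_def[symmetric])
  qed
  ultimately have "integrable \<pi> (\<lambda>z. l (\<beta> \<bullet> snd z))"
    by (rule Bochner_Integration.integrable_bound)
  then show ?thesis using integrable_coupling_snd[OF \<pi> measurable_loss] by simp
qed

context
  fixes \<kappa> \<delta> :: real
  assumes \<kappa>: "M * K \<le> \<kappa>" and \<delta>: "0 < \<delta>" and budget: "budget \<kappa> = \<delta>"
begin

private abbreviation "Pstar \<equiv> distr P borel (transport_map \<kappa>)"

lemma Pstar_borel_prob: "borel_prob Pstar"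
  using measurable_transport_map[OF \<kappa>]
  by (auto simp: borel_prob_def intro!: P.prob_space_distr)

text \<open>The graph of the transport map is a coupling whose cost is exactly the radius, by the
  choice of \<open>\<kappa>\<close>.\<close>

lemma optimal_coupling:
  shows Pstar_ambiguity: "Pstar \<in> ambiguity_set cost P \<delta>"
    and Pstar_integrable_loss: "integrable Pstar (\<lambda>y. l (\<beta> \<bullet> y))"
proof -
  let ?\<pi> = "distr P borel (\<lambda>x. (x, transport_map \<kappa> x))"
  note [measurable] = measurable_transport_map[OF \<kappa>] cost_measurable
  have \<pi>: "?\<pi> \<in> couplings P Pstar" by (rule graph_coupling[OF P]) measurable
  have graph [measurable]: "(\<lambda>x. (x, transport_map \<kappa> x)) \<in> measurable P borel"
    unfolding borel_prod[symmetric] by measurable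
  have "(\<integral>\<^sup>+ z. ennreal (cost (fst z) (snd z)) \<partial>?\<pi>) = (\<integral>\<^sup>+ x. ennreal (cost x (transport_map \<kappa> x)) \<partial>P)"
    by (subst nn_integral_distr) auto
  also have "\<dots> = (\<integral>\<^sup>+ x. ennreal ((shift \<kappa> x)\<^sup>2 * weight x) \<partial>P)"
    using AE_cost_transport_map[OF \<kappa>] by (intro nn_integral_cong_AE) auto
  also have "\<dots> = ennreal \<delta>"
    using nn_integral_eq_integral[OF integrable_shift_sq_weight[OF \<kappa>]] less_imp_le[OF weight_pos] budget
    by (simp add: budget_def)
  finally have eq: "(\<integral>\<^sup>+ z. ennreal (cost (fst z) (snd z)) \<partial>?\<pi>) = ennreal \<delta>" .
  then show "Pstar \<in> ambiguity_set cost P \<delta>"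
    using Pstar_borel_prob transport_cost_leI[OF \<pi>, of cost "ennreal \<delta>"] by (simp add: ambiguity_set_def)
  have "integrable ?\<pi> (\<lambda>z. cost (fst z) (snd z))"
    using eq cost_nonneg by (intro integrableI_nonneg) auto
  then show "integrable Pstar (\<lambda>y. l (\<beta> \<bullet> y))" by (rule integrable_loss[OF \<pi>])
qed

text \<open>The pointwise slack in weak duality: for almost every \<open>x\<close>, the amount by
  which \<open>y\<close> falls short of the maximum of
  \<open>l (\<beta> \<bullet> y) - \<kappa> * cost x y\<close>, which is attained at
  \<open>transport_map \<kappa> x\<close>.\<close>

definition deficiency :: "(real ^ 'n) \<times> (real ^ 'n) \<Rightarrow> real" where
  "deficiency z = l (\<beta> \<bullet> transport_map \<kappa> (fst z)) - \<kappa> * ((shift \<kappa> (fst z))\<^sup>2 * weight (fst z))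
     + \<kappa> * cost (fst z) (snd z) - l (\<beta> \<bullet> snd z)"

text \<open>All terms except the cost depend on one coordinate only, so their integrals are
  determined by the marginals. The coupling enters the total only through its cost.\<close>

lemma
  assumes \<pi>: "\<pi> \<in> couplings P Q" and int: "integrable \<pi> (\<lambda>z. cost (fst z) (snd z))"
  shows integrable_deficiency: "integrable \<pi> deficiency"
    and integral_deficiency: "integral\<^sup>L \<pi> deficiency = (\<integral>y. l (\<beta> \<bullet> y) \<partial>Pstar) - \<kappa> * \<delta>
      + \<kappa> * (\<integral>z. cost (fst z) (snd z) \<partial>\<pi>) - (\<integral>y. l (\<beta> \<bullet> y) \<partial>Q)"
    and AE_deficiency: "AE z in \<pi>. M * K / 2 * rmin * (dist (snd z) (transport_map \<kappa> (fst z)))\<^sup>2 \<le> deficiency z"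
proof -
  note [measurable] = measurable_transport_map[OF \<kappa>] measurable_shift[OF \<kappa>]
  have Tm: "transport_map \<kappa> \<in> measurable P borel" by measurable
  have m1: "(\<lambda>x. l (\<beta> \<bullet> transport_map \<kappa> x)) \<in> borel_measurable borel" by measurable
  have m2: "(\<lambda>x. (shift \<kappa> x)\<^sup>2 * weight x) \<in> borel_measurable borel" by measurable
  have i1: "integrable \<pi> (\<lambda>z. l (\<beta> \<bullet> transport_map \<kappa> (fst z)))"
    using integrable_coupling_fst[OF \<pi> m1] integrable_distr[OF Tm Pstar_integrable_loss] by simp
  have i2: "integrable \<pi> (\<lambda>z. (shift \<kappa> (fst z))\<^sup>2 * weight (fst z))"
    using integrable_coupling_fst[OF \<pi> m2] integrable_shift_sq_weight[OF \<kappa>] by simp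
  have i3: "integrable \<pi> (\<lambda>z. l (\<beta> \<bullet> snd z))"
    using integrable_coupling_snd[OF \<pi> measurable_loss] integrable_loss[OF \<pi> int] by simp
  show "integrable \<pi> deficiency"
    unfolding deficiency_def using i1 i2 i3 int by simp
  have "(\<integral>z. l (\<beta> \<bullet> transport_map \<kappa> (fst z)) \<partial>\<pi>) = (\<integral>y. l (\<beta> \<bullet> y) \<partial>Pstar)"
    using integral_coupling_fst[OF \<pi> m1] integral_distr[OF Tm measurable_loss] by simp
  then show "integral\<^sup>L \<pi> deficiency = (\<integral>y. l (\<beta> \<bullet> y) \<partial>Pstar) - \<kappa> * \<delta>
      + \<kappa> * (\<integral>z. cost (fst z) (snd z) \<partial>\<pi>) - (\<integral>y. l (\<beta> \<bullet> y) \<partial>Q)"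
    unfolding deficiency_def using i1 i2 i3 int integral_coupling_fst[OF \<pi> m2] integral_coupling_snd[OF \<pi> measurable_loss]
      budget by (simp add: budget_def)
  show "AE z in \<pi>. M * K / 2 * rmin * (dist (snd z) (transport_map \<kappa> (fst z)))\<^sup>2 \<le> deficiency z"
    using AE_coupling_fst[OF \<pi> quadratic_deficiency[OF \<kappa>]]
    by eventually_elim (simp add: deficiency_def dist_norm)
qed

text \<open>A coupling with cost at most \<open>\<delta> + \<epsilon> / \<kappa>\<close> is used;
  after multiplication by \<open>\<kappa>\<close> the terms \<open>\<kappa> * \<delta>\<close>
  cancel and the excess is \<open>\<epsilon>\<close>.\<close>

lemma near_optimal_coupling:
  assumes Q: "Q \<in> ambiguity_set cost P \<delta>" and \<epsilon>: "0 < \<epsilon>"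
  obtains \<pi> where "\<pi> \<in> couplings P Q" "integrable \<pi> deficiency" "integrable Q (\<lambda>y. l (\<beta> \<bullet> y))"
    "AE z in \<pi>. M * K / 2 * rmin * (dist (snd z) (transport_map \<kappa> (fst z)))\<^sup>2 \<le> deficiency z"
    "integral\<^sup>L \<pi> deficiency \<le> (\<integral>y. l (\<beta> \<bullet> y) \<partial>Pstar) - (\<integral>y. l (\<beta> \<bullet> y) \<partial>Q) + \<epsilon>"
proof -
  have pos: "0 < \<kappa>" using \<kappa> MK_pos by linarith
  obtain \<pi> where \<pi>: "\<pi> \<in> couplings P Q" and int: "integrable \<pi> (\<lambda>z. cost (fst z) (snd z))"
    and le: "(\<integral>z. cost (fst z) (snd z) \<partial>\<pi>) \<le> \<delta> + \<epsilon> / \<kappa>"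
    using ambiguity_set_coupling[OF Q _ _ cost_measurable cost_nonneg, of "\<epsilon> / \<kappa>"] \<delta> \<epsilon> pos by auto
  have "\<kappa> * (\<integral>z. cost (fst z) (snd z) \<partial>\<pi>) \<le> \<kappa> * (\<delta> + \<epsilon> / \<kappa>)"
    using le pos by (intro mult_left_mono) auto
  also have "\<dots> = \<kappa> * \<delta> + \<epsilon>" using pos by (simp add: field_simps)
  finally have "integral\<^sup>L \<pi> deficiency \<le> (\<integral>y. l (\<beta> \<bullet> y) \<partial>Pstar) - (\<integral>y. l (\<beta> \<bullet> y) \<partial>Q) + \<epsilon>"
    unfolding integral_deficiency[OF \<pi> int] by linarith
  then show thesis
    using that \<pi> integrable_deficiency[OF \<pi> int] AE_deficiency[OF \<pi> int] integrable_loss[OF \<pi> int] by blast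
qed

lemma modulus_pos: "0 < M * K / 2 * rmin"
  using MK_pos rmin_pos by simp

text \<open>The deficiency is nonnegative almost everywhere, so its integral bounds the loss of
  optimality of \<open>Q\<close> from below by \<open>- \<epsilon>\<close>, for every positive
  \<open>\<epsilon>\<close>.\<close>

lemma Pstar_optimal:
  assumes Q: "Q \<in> ambiguity_set cost P \<delta>"
  shows "integrable Q (\<lambda>y. l (\<beta> \<bullet> y))" "(\<integral>y. l (\<beta> \<bullet> y) \<partial>Q) \<le> (\<integral>y. l (\<beta> \<bullet> y) \<partial>Pstar)"
proof -
  show "integrable Q (\<lambda>y. l (\<beta> \<bullet> y))"
    using near_optimal_coupling[OF Q zero_less_one] by blast
  show "(\<integral>y. l (\<beta> \<bullet> y) \<partial>Q) \<le> (\<integral>y. l (\<beta> \<bullet> y) \<partial>Pstar)"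
  proof (rule field_le_epsilon)
    fix \<epsilon> :: real assume "0 < \<epsilon>"
    from near_optimal_coupling[OF Q this] obtain \<pi> where
      le: "AE z in \<pi>. M * K / 2 * rmin * (dist (snd z) (transport_map \<kappa> (fst z)))\<^sup>2 \<le> deficiency z"
      "integral\<^sup>L \<pi> deficiency \<le> (\<integral>y. l (\<beta> \<bullet> y) \<partial>Pstar) - (\<integral>y. l (\<beta> \<bullet> y) \<partial>Q) + \<epsilon>" .
    have "AE z in \<pi>. 0 \<le> deficiency z"
      using le(1)
    proof eventually_elim
      case (elim z)
      have "0 \<le> M * K / 2 * rmin * (dist (snd z) (transport_map \<kappa> (fst z)))\<^sup>2"
        by (rule mult_nonneg_nonneg[OF less_imp_le[OF modulus_pos] zero_le_power2])
      then show ?case using elim by linarith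
    qed
    then have "0 \<le> integral\<^sup>L \<pi> deficiency" by (rule integral_nonneg_AE)
    then show "(\<integral>y. l (\<beta> \<bullet> y) \<partial>Q) \<le> (\<integral>y. l (\<beta> \<bullet> y) \<partial>Pstar) + \<epsilon>" using le(2) by linarith
  qed
qed

lemma SUP_ambiguity:
  "(SUP Q\<in>ambiguity_set cost P \<delta>. ext_expectation Q (\<lambda>y. l (\<beta> \<bullet> y))) = ereal (\<integral>y. l (\<beta> \<bullet> y) \<partial>Pstar)"
proof (rule antisym)
  show "(SUP Q\<in>ambiguity_set cost P \<delta>. ext_expectation Q (\<lambda>y. l (\<beta> \<bullet> y))) \<le> ereal (\<integral>y. l (\<beta> \<bullet> y) \<partial>Pstar)"
    by (rule SUP_least) (simp add: ext_expectation_eq_integral Pstar_optimal)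
  show "ereal (\<integral>y. l (\<beta> \<bullet> y) \<partial>Pstar) \<le> (SUP Q\<in>ambiguity_set cost P \<delta>. ext_expectation Q (\<lambda>y. l (\<beta> \<bullet> y)))"
    unfolding ext_expectation_eq_integral[OF Pstar_integrable_loss, symmetric]
    by (rule SUP_upper[OF Pstar_ambiguity])
qed

lemma worst_case_iff: "worst_case cost P \<delta> (\<lambda>y. l (\<beta> \<bullet> y)) Q \<longleftrightarrow> Q = Pstar"
proof
  assume "Q = Pstar"
  then show "worst_case cost P \<delta> (\<lambda>y. l (\<beta> \<bullet> y)) Q"
    by (simp add: worst_case_def SUP_ambiguity Pstar_ambiguity ext_expectation_eq_integral[OF Pstar_integrable_loss])
next
  assume "worst_case cost P \<delta> (\<lambda>y. l (\<beta> \<bullet> y)) Q"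
  then have Q: "Q \<in> ambiguity_set cost P \<delta>"
    and "ext_expectation Q (\<lambda>y. l (\<beta> \<bullet> y)) = ereal (\<integral>y. l (\<beta> \<bullet> y) \<partial>Pstar)"
    by (auto simp: worst_case_def SUP_ambiguity)
  then have eq: "(\<integral>y. l (\<beta> \<bullet> y) \<partial>Q) = (\<integral>y. l (\<beta> \<bullet> y) \<partial>Pstar)"
    by (simp add: ext_expectation_eq_integral Pstar_optimal)
  show "Q = Pstar"
  proof (rule eq_distr_if_couplings_concentrate[OF P _ measurable_transport_map[OF \<kappa>]])
    show "borel_prob Q" using Q by (simp add: ambiguity_set_def)
    fix \<eta> :: real assume \<eta>: "0 < \<eta>"
    let ?m = "M * K / 2 * rmin"
    \<comment> \<open>Both laws have the same value, so only the slack bounds the mean deficiency.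
      Taking it to be \<open>?m * \<eta>\<close> leaves \<open>\<eta>\<close> after division by the
      modulus.\<close>
    have "0 < ?m * \<eta>" using modulus_pos \<eta> by (rule mult_pos_pos)
    from near_optimal_coupling[OF Q this] obtain \<pi> where \<pi>: "\<pi> \<in> couplings P Q" "integrable \<pi> deficiency"
      and le: "AE z in \<pi>. ?m * (dist (snd z) (transport_map \<kappa> (fst z)))\<^sup>2 \<le> deficiency z"
      "integral\<^sup>L \<pi> deficiency \<le> (\<integral>y. l (\<beta> \<bullet> y) \<partial>Pstar) - (\<integral>y. l (\<beta> \<bullet> y) \<partial>Q) + ?m * \<eta>" .
    show "\<exists>\<pi>\<in>couplings P Q. \<exists>d. integrable \<pi> d \<and>
      (AE z in \<pi>. (dist (snd z) (transport_map \<kappa> (fst z)))\<^sup>2 \<le> d z) \<and> integral\<^sup>L \<pi> d \<le> \<eta>"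
    proof (intro bexI[OF _ \<pi>(1)] exI[of _ "\<lambda>z. deficiency z / ?m"] conjI)
      show "integrable \<pi> (\<lambda>z. deficiency z / ?m)" using \<pi>(2) by (rule integrable_divide)
      show "AE z in \<pi>. (dist (snd z) (transport_map \<kappa> (fst z)))\<^sup>2 \<le> deficiency z / ?m"
        using le(1) by eventually_elim (simp only: pos_le_divide_eq[OF modulus_pos] mult.commute[of _ ?m])
      have "integral\<^sup>L \<pi> deficiency \<le> \<eta> * ?m" using le(2) eq by (simp add: mult.commute)
      then show "(\<integral>z. deficiency z / ?m \<partial>\<pi>) \<le> \<eta>"
        unfolding integral_divide_zero by (simp only: pos_divide_le_eq[OF modulus_pos])
    qed
  qed
qed

end

end

section \<open>Worst-case laws for small radii and monotonicity of the displacements\<close>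

theorem theorem7:
  fixes B :: "(real ^ 'n) set"
    and P\<^sub>0 :: "(real ^ 'n) measure"
    and \<Omega> :: "'w measure"
    and X :: "'w \<Rightarrow> real ^ 'n"
    and l :: "real \<Rightarrow> real"
    and A :: "real ^ 'n \<Rightarrow> real ^ 'n ^ 'n"
    and \<rho>min \<rho>max M Llow Lup R :: real
    and c\<^sub>1 c\<^sub>2 p :: "real ^ 'n \<Rightarrow> real"
    and \<beta> :: "real ^ 'n"
    and \<delta>\<^sub>1 :: real
  assumes P0: "borel_prob P\<^sub>0"
    and Omega: "prob_space \<Omega>"
    and X: "X \<in> borel_measurable \<Omega>" "distr \<Omega> borel X = P\<^sub>0"
    and A: "\<And>x. sym_pos_def (A x)"
    and cost_lsc: "lower_semicontinuous (\<lambda>(x, x'). mahalanobis_cost A x x')"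
    and rho_pos: "0 < \<rho>min" "0 < \<rho>max"
    and rho: "AE x in P\<^sub>0. \<forall>v. norm v = 1 \<longrightarrow> \<rho>min \<le> v \<bullet> (A x *v v) \<and> v \<bullet> (A x *v v) \<le> \<rho>max"
    and l_convex: "convex_on UNIV l"
    and l_growth: "\<bar>quadratic_growth_rate l\<bar> \<noteq> \<infinity>"
    and fourth_moment: "integrable P\<^sub>0 (\<lambda>x. norm x ^ 4)"
    and l_diff: "\<And>u. l differentiable (at u)" "\<And>u. deriv l differentiable (at u)"
    and M: "0 < M" "\<And>u. deriv (deriv l) u \<le> M"
    and l_nonzero: "\<And>b. b \<in> B \<Longrightarrow> \<not> (AE x in P\<^sub>0. deriv l (b \<bullet> x) = 0)"
    and B: "convex B" "compact B"
    and R: "R = (SUP b\<in>B. norm b)"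
    and L_pos: "0 < Llow" "0 < Lup"
    and L: "\<And>b. b \<in> B \<Longrightarrow> Llow \<le> (LINT x|P\<^sub>0. (deriv l (b \<bullet> x))\<^sup>2)"
           "\<And>b. b \<in> B \<Longrightarrow> (LINT x|P\<^sub>0. (deriv l (b \<bullet> x))\<^sup>2) \<le> Lup"
    and nondeg_consts: "\<And>b. b \<in> B - {0} \<Longrightarrow> 0 < c\<^sub>1 b \<and> 0 < c\<^sub>2 b \<and> 0 < p b \<and> p b < 1"
    and nondeg: "\<And>b. b \<in> B - {0} \<Longrightarrow>
           measure P\<^sub>0 {x. \<bar>deriv l (b \<bullet> x)\<bar> > c\<^sub>1 b \<and> \<bar>b \<bullet> x\<bar> > c\<^sub>2 b * norm b} \<ge> p b"
    and beta: "\<beta> \<in> B - {0}"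
    and delta1: "\<delta>\<^sub>1 = delta1 \<rho>min \<rho>max Llow Lup R M (c\<^sub>1 \<beta>) (c\<^sub>2 \<beta>) (p \<beta>)"
  shows "\<exists>Pstar.
    (\<forall>\<delta>. 0 < \<delta> \<and> \<delta> < \<delta>\<^sub>1 \<longrightarrow>
       worst_case (mahalanobis_cost A) P\<^sub>0 \<delta> (\<lambda>x. l (\<beta> \<bullet> x)) (Pstar \<delta>) \<and>
       (\<forall>P. worst_case (mahalanobis_cost A) P\<^sub>0 \<delta> (\<lambda>x. l (\<beta> \<bullet> x)) P \<longrightarrow> P = Pstar \<delta>)) \<and>
    (\<exists>G :: real \<Rightarrow> 'w \<Rightarrow> real.
       (\<forall>\<delta>. 0 < \<delta> \<and> \<delta> < \<delta>\<^sub>1 \<longrightarrow>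
          G \<delta> \<in> borel_measurable \<Omega> \<and>
          transported A \<beta> X (\<lambda>\<omega>. sqrt \<delta> * G \<delta> \<omega>) \<in> borel_measurable \<Omega> \<and>
          distr \<Omega> borel (transported A \<beta> X (\<lambda>\<omega>. sqrt \<delta> * G \<delta> \<omega>)) = Pstar \<delta>) \<and>
       (\<forall>\<omega>\<in>space \<Omega>. \<forall>\<delta> \<delta>'. 0 < \<delta> \<and> \<delta> < \<delta>' \<and> \<delta>' < \<delta>\<^sub>1 \<and> deriv l (\<beta> \<bullet> X \<omega>) > 0 \<longrightarrow>
          0 < sqrt \<delta> * G \<delta> \<omega> \<and> sqrt \<delta> * G \<delta> \<omega> < sqrt \<delta>' * G \<delta>' \<omega>) \<and>
       (\<forall>\<omega>\<in>space \<Omega>. \<forall>\<delta> \<delta>'. 0 < \<delta> \<and> \<delta> < \<delta>' \<and> \<delta>' < \<delta>\<^sub>1 \<and> deriv l (\<beta> \<bullet> X \<omega>) < 0 \<longrightarrow>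
          sqrt \<delta>' * G \<delta>' \<omega> < sqrt \<delta> * G \<delta> \<omega> \<and> sqrt \<delta> * G \<delta> \<omega> < 0) \<and>
       (\<forall>\<omega>\<in>space \<Omega>. \<forall>\<delta>. 0 < \<delta> \<and> \<delta> < \<delta>\<^sub>1 \<and> deriv l (\<beta> \<bullet> X \<omega>) = 0 \<longrightarrow> G \<delta> \<omega> = 0) \<and>
       (\<forall>\<delta> \<delta>'. 0 < \<delta> \<and> \<delta> < \<delta>' \<and> \<delta>' < \<delta>\<^sub>1 \<longrightarrow>
          (AE \<omega> in \<Omega>.
             norm (transported A \<beta> X (\<lambda>\<omega>. sqrt \<delta> * G \<delta> \<omega>) \<omega> - X \<omega>)
             \<le> norm (transported A \<beta> X (\<lambda>\<omega>. sqrt \<delta>' * G \<delta>' \<omega>) \<omega> - X \<omega>))))"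
proof -
  have beta0: "\<beta> \<noteq> 0" and betaB: "\<beta> \<in> B" using beta by auto
  have prob: "prob_space P\<^sub>0" and sets: "sets P\<^sub>0 = sets borel" using P0 by (auto simp: borel_prob_def)
  have second_moment: "integrable P\<^sub>0 (\<lambda>x. (norm x)\<^sup>2)"
  proof (rule Bochner_Integration.integrable_bound)
    show "integrable P\<^sub>0 (\<lambda>x. 1 + norm x ^ 4)"
      using fourth_moment prob by (simp add: prob_space.finite_measure finite_measure.integrable_const)
    have "(norm x)\<^sup>2 \<le> 1 + norm x ^ 4" for x :: "real ^ 'n"
    proof -
      have "2 * (norm x)\<^sup>2 \<le> norm x ^ 4 + 1"
        using zero_le_power2[of "(norm x)\<^sup>2 - 1"] unfolding power2_diff by (simp flip: power_mult)
      moreover have "0 \<le> (norm x)\<^sup>2" by simp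
      ultimately show ?thesis by linarith
    qed
    then show "AE x in P\<^sub>0. norm ((norm x)\<^sup>2) \<le> norm (1 + norm x ^ 4)" by simp
    show "(\<lambda>x. (norm x)\<^sup>2) \<in> borel_measurable P\<^sub>0"
      by (simp add: measurable_cong_sets[OF sets refl])
  qed
  have cost_measurable: "(\<lambda>z. mahalanobis_cost A (fst z) (snd z)) \<in> borel_measurable borel"
    using lower_semicontinuous_measurable[OF cost_lsc] by (simp add: case_prod_unfold)
  interpret quadratic_transport l M P\<^sub>0 A \<beta> \<rho>min \<rho>max
    using l_convex l_diff M P0 A cost_measurable rho_pos rho second_moment beta0 by unfold_locales auto

  \<comment> \<open>Replacing \<open>R\<close> by \<open>norm \<beta>\<close> enlarges
    \<open>delta0\<close>. A quarter of the result is the lower bound of \<open>budget_ge\<close> at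
    \<open>M * K\<close> with \<open>Llow\<close> in place of \<open>slope_energy\<close>, so every
    radius below \<delta>\<open>\<^sub>1\<close> has a multiplier.\<close>
  have "norm \<beta> \<le> R"
    unfolding R using betaB compact_imp_bounded[OF B(2)]
    by (intro cSUP_upper) (auto simp: bounded_iff bdd_above_def)
  then have "\<rho>min\<^sup>2 * Llow / (R\<^sup>2 * M\<^sup>2 * \<rho>max) \<le> \<rho>min\<^sup>2 * Llow / ((norm \<beta>)\<^sup>2 * M\<^sup>2 * \<rho>max)"
    using beta0 M rho_pos L_pos
    by (intro divide_left_mono mult_right_mono power_mono mult_pos_pos) auto
  also have "\<dots> / 4 = (norm \<beta>)\<^sup>2 / (4 * (M * K)\<^sup>2 * \<rho>max) * Llow"
    using beta0 M rho_pos by (simp add: K_def field_simps power2_eq_square)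
  also have "\<dots> \<le> (norm \<beta>)\<^sup>2 / (4 * (M * K)\<^sup>2 * \<rho>max) * slope_energy"
    using L(1)[OF betaB] rho_pos unfolding slope_energy_def by (intro mult_left_mono) auto
  also have "\<dots> \<le> budget (M * K)" by (rule budget_ge) simp
  finally have delta1_le: "\<delta>\<^sub>1 \<le> budget (M * K)"
    by (simp add: delta1 delta1_def delta0_def min.coboundedI1)

  have "\<exists>\<kappa>. \<forall>\<delta>. 0 < \<delta> \<and> \<delta> < \<delta>\<^sub>1 \<longrightarrow> M * K \<le> \<kappa> \<delta> \<and> budget (\<kappa> \<delta>) = \<delta>"
    using multiplier_exists delta1_le by (metis less_imp_le order_trans)
  then obtain \<kappa> where \<kappa>: "M * K \<le> \<kappa> \<delta>" "budget (\<kappa> \<delta>) = \<delta>" if "0 < \<delta>" "\<delta> < \<delta>\<^sub>1" for \<delta>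
    by blast
  \<comment> \<open>The multipliers are chosen arbitrarily for each radius. Strictness holds because
    \<open>\<kappa> \<delta> \<le> \<kappa> \<delta>'\<close> would give
    \<open>\<delta>' \<le> \<delta>\<close> by antimonotonicity of the budget.\<close>
  have \<kappa>_decreasing: "\<kappa> \<delta>' < \<kappa> \<delta>" if "0 < \<delta>" "\<delta> < \<delta>'" "\<delta>' < \<delta>\<^sub>1" for \<delta> \<delta>'
    using budget_antimono[of "\<kappa> \<delta>" "\<kappa> \<delta>'"] \<kappa>[of \<delta>] \<kappa>[of \<delta>'] that by fastforce

  \<comment> \<open>Dividing by \<open>sqrt \<delta>\<close> makes
    \<open>sqrt \<delta> * G \<delta>\<close> the shift itself, so radii are compared through their
    multipliers alone.\<close>
  define G where "G \<delta> \<omega> = shift (\<kappa> \<delta>) (X \<omega>) / sqrt \<delta>" for \<delta> \<omega>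
  have G: "sqrt \<delta> * G \<delta> \<omega> = shift (\<kappa> \<delta>) (X \<omega>)" if "0 < \<delta>" for \<delta> \<omega>
    using that by (simp add: G_def)
  have transported_eq: "transported A \<beta> X (\<lambda>\<omega>. sqrt \<delta> * G \<delta> \<omega>) = (\<lambda>\<omega>. transport_map (\<kappa> \<delta>) (X \<omega>))"
    if "0 < \<delta>" for \<delta>
    using that by (simp add: fun_eq_iff transported_def transport_map_def G)

  have worst: "worst_case (mahalanobis_cost A) P\<^sub>0 \<delta> (\<lambda>x. l (\<beta> \<bullet> x)) P \<longleftrightarrow>
      P = distr P\<^sub>0 borel (transport_map (\<kappa> \<delta>))" if "0 < \<delta>" "\<delta> < \<delta>\<^sub>1" for \<delta> P
    by (rule worst_case_iff[OF \<kappa>(1)[OF that] that(1) \<kappa>(2)[OF that]])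

  have law: "G \<delta> \<in> borel_measurable \<Omega>"
    "transported A \<beta> X (\<lambda>\<omega>. sqrt \<delta> * G \<delta> \<omega>) \<in> borel_measurable \<Omega>"
    "distr \<Omega> borel (transported A \<beta> X (\<lambda>\<omega>. sqrt \<delta> * G \<delta> \<omega>)) = distr P\<^sub>0 borel (transport_map (\<kappa> \<delta>))"
    if "0 < \<delta>" "\<delta> < \<delta>\<^sub>1" for \<delta>
  proof -
    note [measurable] = X(1) measurable_shift[OF \<kappa>(1)[OF that]] measurable_transport_map[OF \<kappa>(1)[OF that]]
    show "G \<delta> \<in> borel_measurable \<Omega>" unfolding G_def by measurable
    show "transported A \<beta> X (\<lambda>\<omega>. sqrt \<delta> * G \<delta> \<omega>) \<in> borel_measurable \<Omega>"
      unfolding transported_eq[OF that(1)] by measurable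
    show "distr \<Omega> borel (transported A \<beta> X (\<lambda>\<omega>. sqrt \<delta> * G \<delta> \<omega>)) = distr P\<^sub>0 borel (transport_map (\<kappa> \<delta>))"
      unfolding transported_eq[OF that(1)] X(2)[symmetric] by (subst distr_distr) (auto simp: comp_def)
  qed

  have w: "0 \<le> weight x" "M * weight x < 2 * \<kappa> \<delta>" if "0 < \<delta>" "\<delta> < \<delta>\<^sub>1" for \<delta> x
    using weight_gap[OF \<kappa>(1)[OF that]] by auto
  \<comment> \<open>The larger radius \<delta>' has the smaller multiplier, hence the larger
    displacement. The cap in \<open>weight\<close> lets this hold at every \<omega>, not merely
    almost surely.\<close>
  have pos: "0 < sqrt \<delta> * G \<delta> \<omega> \<and> sqrt \<delta> * G \<delta> \<omega> < sqrt \<delta>' * G \<delta>' \<omega>"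
    if "0 < \<delta>" "\<delta> < \<delta>'" "\<delta>' < \<delta>\<^sub>1" "0 < deriv l (\<beta> \<bullet> X \<omega>)" for \<delta> \<delta>' \<omega>
    using that displacement_pos_iff[OF w[of \<delta>]] displacement_decreasing[OF w[of \<delta>'] \<kappa>_decreasing[of \<delta> \<delta>']]
    by (simp add: G shift_def)
  have neg: "sqrt \<delta>' * G \<delta>' \<omega> < sqrt \<delta> * G \<delta> \<omega> \<and> sqrt \<delta> * G \<delta> \<omega> < 0"
    if "0 < \<delta>" "\<delta> < \<delta>'" "\<delta>' < \<delta>\<^sub>1" "deriv l (\<beta> \<bullet> X \<omega>) < 0" for \<delta> \<delta>' \<omega>
    using that displacement_neg_iff[OF w[of \<delta>]] displacement_increasing[OF w[of \<delta>'] \<kappa>_decreasing[of \<delta> \<delta>']]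
    by (simp add: G shift_def)
  have zero: "G \<delta> \<omega> = 0" if "0 < \<delta>" "\<delta> < \<delta>\<^sub>1" "deriv l (\<beta> \<bullet> X \<omega>) = 0" for \<delta> \<omega>
    using that displacement_eq_0_iff[OF w[of \<delta>]] by (simp add: G_def shift_def)
  have mono: "norm (transported A \<beta> X (\<lambda>\<omega>. sqrt \<delta> * G \<delta> \<omega>) \<omega> - X \<omega>)
      \<le> norm (transported A \<beta> X (\<lambda>\<omega>. sqrt \<delta>' * G \<delta>' \<omega>) \<omega> - X \<omega>)"
    if "0 < \<delta>" "\<delta> < \<delta>'" "\<delta>' < \<delta>\<^sub>1" for \<delta> \<delta>' \<omega>
    using that abs_displacement_antimono[OF w[of \<delta>'] less_imp_le[OF \<kappa>_decreasing[of \<delta> \<delta>']]]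
    by (simp add: transported_def G shift_def mult_right_mono)

  show ?thesis
    by (intro exI[of _ "\<lambda>\<delta>. distr P\<^sub>0 borel (transport_map (\<kappa> \<delta>))"] conjI exI[of _ G] allI impI ballI AE_I2)
      (simp_all add: worst law pos neg zero mono, (use pos neg in blast)+)
qed

end
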